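(* Let a continuous 2D hyperbolic system with a Bäcklund transformation, with smooth right-hand sides $f,g,u,v,\xi,\eta$, be given, together with Goursat data consisting of smooth functions $a_0,b_0:[0,r]\to\mathcal X$ and a sequence $\theta_0(z)\in\mathcal X$, $z\in\{0,1,\dots,R\}$. Let a family of discrete 3D hyperbolic systems with right-hand sides $f^\epsilon,g^\epsilon,u^\epsilon,v^\epsilon,\xi^\epsilon,\eta^\epsilon$, satisfying the discrete compatibility conditions, approximate it to order $\mathcal O(\epsilon)$ in the $C^1$ sense: $f^\epsilon(a,b)=f(a,b)+\mathcal O(\epsilon)$, and likewise for $g,u,v,\xi,\eta$, and similar relations for the first partial derivatives, hold uniformly on any bounded set of $(a,b,\theta)\in\mathcal X^3$. Let discrete initial data satisfy $$a_0^\epsilon(x)=a_0(x)+\mathcal O(\epsilon),\quad b_0^\epsilon(y)=b_0(y)+\mathcal O(\epsilon),\quad \theta_0^\epsilon(z)=\theta_0(z)+\mathcal O(\epsilon)$$ uniformly for $x\in[0,r]^\epsilon$, $y\in[0,r]^\epsilon$, $z\in\{0,1,\dots,R\}$, respectively, and let $(a^\epsilon,b^\epsilon,\theta^\epsilon)$ be the solutions of the corresponding discrete Goursat problems on $\Omega^\epsilon(r,R)$. Then for some $\bar r\in(0,r]$ the sequence of solutions has a uniform limit of Lipschitz-continuous functions $a,b,\theta:\Omega(\bar r,R)\to\mathcal X$ in the sense that $$a^\epsilon(x,y,z)=a(x,y,z)+\mathcal O(\epsilon),\quad b^\epsilon(x,y,z)=b(x,y,z)+\mathcal O(\epsilon),\quad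 \theta^\epsilon(x,y,z)=\theta(x,y,z)+\mathcal O(\epsilon)$$ hold uniformly for $(x,y,z)$ in the respective $\Omega^\epsilon(\bar r,R)$. Furthermore, $(a,b,\theta)$ solve the Goursat problem (with data $a_0,b_0,\theta_0$) for the continuous 2D system with a sequence of Bäcklund transformations.
   Context: $\mathcal X$ is a normed vector space, $r>0$, $R$ a positive integer. For $\rho>0$: $\Omega(\rho,R)=[0,\rho]\times[0,\rho]\times\{0,1,\dots,R\}$, $[0,\rho]^\epsilon=[0,\rho]\cap(\epsilon\mathbb Z)$, $\Omega^\epsilon(\rho,R)=[0,\rho]^\epsilon\times[0,\rho]^\epsilon\times\{0,1,\dots,R\}$. The mesh size $\epsilon$ takes only (small) values $2^{-k}$, $k$ a positive integer; $\mathcal O(\epsilon)$ means bounded in norm by $C\epsilon$ with $C$ independent of $\epsilon$ and of the indicated variables. $\delta^\epsilon_x$, $\delta^\epsilon_y$ are the forward difference quotients with step $\epsilon$ in $x$, $y$; $\delta_z p(x,y,z)=p(x,y,z+1)-p(x,y,z)$; equations are required wherever both sides make sense. A continuous 2D hyperbolic system with a Bäcklund transformation is a system $$\partial_y a=f(a,b),\ \partial_x b=g(a,b),\ \partial_x\theta=u(a,\theta),\ \partial_y\theta=v(b,\theta),\ \delta_z a=\xi(a,\theta),\ \delta_z b=\eta(b,\theta)$$ for $a,b,\theta:\Omega(r,R)\to\mathcal X$, with smooth $f,g,u,v,\xi,\eta:\mathcal X\times\mathcal X\to\mathcal X$, which is compatible, i.e. identically in $a,b,\theta\in\mathcal X$: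 $$D_au(a,\theta)f(a,b)+D_\theta u(a,\theta)v(b,\theta)=D_bv(b,\theta)g(a,b)+D_\theta v(b,\theta)u(a,\theta),$$ $$D_a\xi(a,\theta)f(a,b)+D_\theta\xi(a,\theta)v(b,\theta)=f(a+\xi(a,\theta),b+\eta(b,\theta))-f(a,b),$$ $$D_b\eta(b,\theta)g(a,b)+D_\theta\eta(b,\theta)u(a,\theta)=g(a+\xi(a,\theta),b+\eta(b,\theta))-g(a,b).$$ Its Goursat problem prescribes $a(x,0,0)=a_0(x)$, $b(0,y,0)=b_0(y)$, $\theta(0,0,z)=\theta_0(z)$. A discrete 3D hyperbolic system is $$\delta^\epsilon_y a=f^\epsilon(a,b),\ \delta^\epsilon_x b=g^\epsilon(a,b),\ \delta^\epsilon_x\theta=u^\epsilon(a,\theta),\ \delta^\epsilon_y\theta=v^\epsilon(b,\theta),\ \delta_z a=\xi^\epsilon(a,\theta),\ \delta_z b=\eta^\epsilon(b,\theta)$$ for $a,b,\theta:\Omega^\epsilon(r,R)\to\mathcal X$ with smooth enough right-hand sides $\mathcal X\times\mathcal X\to\mathcal X$. Its compatibility conditions are, identically in $a,b,\theta\in\mathcal X$: $$u^\epsilon(a+\epsilon f^\epsilon(a,b),\theta+\epsilon v^\epsilon(b,\theta))-u^\epsilon(a,\theta)=v^\epsilon(b+\epsilon g^\epsilon(a,b),\theta+\epsilon u^\epsilon(a,\theta))-v^\epsilon(b,\theta),$$ $$\xi^\epsilon(a+\epsilon f^\epsilon(a,b),\theta+\epsilon v^\epsilon(b,\theta))-\xi^\epsilon(a,\theta)=\epsilon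 f^\epsilon(a+\xi^\epsilon(a,\theta),b+\eta^\epsilon(b,\theta))-\epsilon f^\epsilon(a,b),$$ $$\eta^\epsilon(b+\epsilon g^\epsilon(a,b),\theta+\epsilon u^\epsilon(a,\theta))-\eta^\epsilon(b,\theta)=\epsilon g^\epsilon(a+\xi^\epsilon(a,\theta),b+\eta^\epsilon(b,\theta))-\epsilon g^\epsilon(a,b).$$ Its Goursat problem prescribes $a(x,0,0)=a_0^\epsilon(x)$, $b(0,y,0)=b_0^\epsilon(y)$, $\theta(0,0,z)=\theta_0^\epsilon(z)$ for $x,y\in[0,r]^\epsilon$, $z\in\{0,\dots,R\}$, and has a unique solution.
   Formalization: The normed vector space is assumed complete (a Banach space); without completeness the limit of the discrete solutions can lie outside the space, e.g. f(a,b)=Aa with A the right shift on finitely supported sequences in the l2 norm. *)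

theory Defs
  imports "HOL-Analysis.Analysis"
begin

section \<open>Smoothness\<close>

text \<open>
  \<open>C_on 1\<close> is continuous (Frechet) differentiability, with the derivative continuous in operator
  norm. Since the type of iterated total derivatives changes with the order, higher derivatives are
  taken along fixed directions. Hence an individual \<open>C_on k\<close> with \<open>k \<ge> 2\<close> may be weaker than
  \<open>k\<close>-fold continuous Frechet differentiability if the domain is infinite-dimensional. For all \<open>k\<close>
  together there is no difference: on a Banach space, by the uniform boundedness principle, the
  derivatives of order \<open>k + 1\<close> are locally bounded as multilinear maps, so those of order \<open>k\<close> are
  locally Lipschitz in operator norm.
\<close>

primrec C_on :: "nat \<Rightarrow> 'a::real_normed_vector set \<Rightarrow> ('a \<Rightarrow> 'b::real_normed_vector) \<Rightarrow> bool" where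
  "C_on 0 S f \<longleftrightarrow> continuous_on S f"
| "C_on (Suc k) S f \<longleftrightarrow>
    (\<exists>f' :: 'a \<Rightarrow> 'a \<Rightarrow>\<^sub>L 'b.
       (\<forall>x\<in>S. (f has_derivative blinfun_apply (f' x)) (at x within S)) \<and>
       continuous_on S f' \<and>
       (\<forall>v. C_on k S (\<lambda>x. blinfun_apply (f' x) v)))"

definition smooth_on :: "'a::real_normed_vector set \<Rightarrow> ('a \<Rightarrow> 'b::real_normed_vector) \<Rightarrow> bool" where
  "smooth_on S f \<longleftrightarrow> (\<forall>k. C_on k S f)"

text \<open>Partial derivatives of a function of two arguments, as linear maps.\<close>

definition D1 ::
  "('a::real_normed_vector \<Rightarrow> 'b::real_normed_vector \<Rightarrow> 'c::real_normed_vector) \<Rightarrow> 'a \<Rightarrow> 'b \<Rightarrow> 'a \<Rightarrow> 'c"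
  where "D1 F p q = frechet_derivative (\<lambda>p'. F p' q) (at p)"

definition D2 ::
  "('a::real_normed_vector \<Rightarrow> 'b::real_normed_vector \<Rightarrow> 'c::real_normed_vector) \<Rightarrow> 'a \<Rightarrow> 'b \<Rightarrow> 'b \<Rightarrow> 'c"
  where "D2 F p q = frechet_derivative (\<lambda>q'. F p q') (at q)"


section \<open>Domains and mesh sizes\<close>

definition Omega :: "real \<Rightarrow> nat \<Rightarrow> (real \<times> real \<times> nat) set" where
  "Omega \<rho> R = {0..\<rho>} \<times> {0..\<rho>} \<times> {0..R}"

definition grid :: "real \<Rightarrow> real \<Rightarrow> real set" where
  "grid \<epsilon> \<rho> = {0..\<rho>} \<inter> range (\<lambda>m::int. \<epsilon> * of_int m)"

definition Omega_grid :: "real \<Rightarrow> real \<Rightarrow> nat \<Rightarrow> (real \<times> real \<times> nat) set" where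
  "Omega_grid \<epsilon> \<rho> R = grid \<epsilon> \<rho> \<times> grid \<epsilon> \<rho> \<times> {0..R}"

text \<open>The lower bound \<open>k0\<close> on the exponent expresses that only small mesh sizes need be considered.\<close>

definition mesh_sizes :: "nat \<Rightarrow> real set" where
  "mesh_sizes k0 = {(1/2) ^ k | k. k \<ge> k0}"

definition bigO_uniformly ::
  "real set \<Rightarrow> (real \<Rightarrow> 'p set) \<Rightarrow> (real \<Rightarrow> 'p \<Rightarrow> 'a::real_normed_vector) \<Rightarrow> ('p \<Rightarrow> 'a) \<Rightarrow> bool" where
  "bigO_uniformly E P p\<epsilon> p \<longleftrightarrow> (\<exists>C. \<forall>\<epsilon>\<in>E. \<forall>t\<in>P \<epsilon>. norm (p\<epsilon> \<epsilon> t - p t) \<le> C * \<epsilon>)"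


section \<open>Continuous 2D systems with Backlund transformations\<close>

definition compatible ::
  "('a::real_normed_vector \<Rightarrow> 'a \<Rightarrow> 'a) \<Rightarrow> ('a \<Rightarrow> 'a \<Rightarrow> 'a) \<Rightarrow> ('a \<Rightarrow> 'a \<Rightarrow> 'a) \<Rightarrow>
   ('a \<Rightarrow> 'a \<Rightarrow> 'a) \<Rightarrow> ('a \<Rightarrow> 'a \<Rightarrow> 'a) \<Rightarrow> ('a \<Rightarrow> 'a \<Rightarrow> 'a) \<Rightarrow> bool" where
  "compatible f g u v \<xi> \<eta> \<longleftrightarrow>
    (\<forall>a b \<theta>.
      D1 u a \<theta> (f a b) + D2 u a \<theta> (v b \<theta>) = D1 v b \<theta> (g a b) + D2 v b \<theta> (u a \<theta>) \<and>
      D1 \<xi> a \<theta> (f a b) + D2 \<xi> a \<theta> (v b \<theta>) = f (a + \<xi> a \<theta>) (b + \<eta> b \<theta>) - f a b \<and>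
      D1 \<eta> b \<theta> (g a b) + D2 \<eta> b \<theta> (u a \<theta>) = g (a + \<xi> a \<theta>) (b + \<eta> b \<theta>) - g a b)"

definition solves_continuous_Goursat ::
  "real \<Rightarrow> nat \<Rightarrow>
   ('a::real_normed_vector \<Rightarrow> 'a \<Rightarrow> 'a) \<Rightarrow> ('a \<Rightarrow> 'a \<Rightarrow> 'a) \<Rightarrow> ('a \<Rightarrow> 'a \<Rightarrow> 'a) \<Rightarrow>
   ('a \<Rightarrow> 'a \<Rightarrow> 'a) \<Rightarrow> ('a \<Rightarrow> 'a \<Rightarrow> 'a) \<Rightarrow> ('a \<Rightarrow> 'a \<Rightarrow> 'a) \<Rightarrow>
   (real \<Rightarrow> 'a) \<Rightarrow> (real \<Rightarrow> 'a) \<Rightarrow> (nat \<Rightarrow> 'a) \<Rightarrow>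
   (real \<times> real \<times> nat \<Rightarrow> 'a) \<Rightarrow> (real \<times> real \<times> nat \<Rightarrow> 'a) \<Rightarrow> (real \<times> real \<times> nat \<Rightarrow> 'a) \<Rightarrow> bool" where
  "solves_continuous_Goursat \<rho> R f g u v \<xi> \<eta> a0 b0 \<theta>0 a b \<theta> \<longleftrightarrow>
    (\<forall>(x, y, z) \<in> Omega \<rho> R.
      ((\<lambda>t. a (x, t, z)) has_vector_derivative f (a (x, y, z)) (b (x, y, z))) (at y within {0..\<rho>}) \<and>
      ((\<lambda>t. b (t, y, z)) has_vector_derivative g (a (x, y, z)) (b (x, y, z))) (at x within {0..\<rho>}) \<and>
      ((\<lambda>t. \<theta> (t, y, z)) has_vector_derivative u (a (x, y, z)) (\<theta> (x, y, z))) (at x within {0..\<rho>}) \<and>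
      ((\<lambda>t. \<theta> (x, t, z)) has_vector_derivative v (b (x, y, z)) (\<theta> (x, y, z))) (at y within {0..\<rho>}) \<and>
      (z < R \<longrightarrow>
        a (x, y, z + 1) - a (x, y, z) = \<xi> (a (x, y, z)) (\<theta> (x, y, z)) \<and>
        b (x, y, z + 1) - b (x, y, z) = \<eta> (b (x, y, z)) (\<theta> (x, y, z)))) \<and>
    (\<forall>x\<in>{0..\<rho>}. a (x, 0, 0) = a0 x) \<and>
    (\<forall>y\<in>{0..\<rho>}. b (0, y, 0) = b0 y) \<and>
    (\<forall>z\<in>{0..R}. \<theta> (0, 0, z) = \<theta>0 z)"


section \<open>Discrete 3D systems\<close>

definition discrete_compatible ::
  "real \<Rightarrow>
   ('a::real_normed_vector \<Rightarrow> 'a \<Rightarrow> 'a) \<Rightarrow> ('a \<Rightarrow> 'a \<Rightarrow> 'a) \<Rightarrow> ('a \<Rightarrow> 'a \<Rightarrow> 'a) \<Rightarrow>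
   ('a \<Rightarrow> 'a \<Rightarrow> 'a) \<Rightarrow> ('a \<Rightarrow> 'a \<Rightarrow> 'a) \<Rightarrow> ('a \<Rightarrow> 'a \<Rightarrow> 'a) \<Rightarrow> bool" where
  "discrete_compatible \<epsilon> f g u v \<xi> \<eta> \<longleftrightarrow>
    (\<forall>a b \<theta>.
      u (a + \<epsilon> *\<^sub>R f a b) (\<theta> + \<epsilon> *\<^sub>R v b \<theta>) - u a \<theta> =
        v (b + \<epsilon> *\<^sub>R g a b) (\<theta> + \<epsilon> *\<^sub>R u a \<theta>) - v b \<theta> \<and>
      \<xi> (a + \<epsilon> *\<^sub>R f a b) (\<theta> + \<epsilon> *\<^sub>R v b \<theta>) - \<xi> a \<theta> =
        \<epsilon> *\<^sub>R f (a + \<xi> a \<theta>) (b + \<eta> b \<theta>) - \<epsilon> *\<^sub>R f a b \<and>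
      \<eta> (b + \<epsilon> *\<^sub>R g a b) (\<theta> + \<epsilon> *\<^sub>R u a \<theta>) - \<eta> b \<theta> =
        \<epsilon> *\<^sub>R g (a + \<xi> a \<theta>) (b + \<eta> b \<theta>) - \<epsilon> *\<^sub>R g a b)"

definition solves_discrete_Goursat ::
  "real \<Rightarrow> real \<Rightarrow> nat \<Rightarrow>
   ('a::real_normed_vector \<Rightarrow> 'a \<Rightarrow> 'a) \<Rightarrow> ('a \<Rightarrow> 'a \<Rightarrow> 'a) \<Rightarrow> ('a \<Rightarrow> 'a \<Rightarrow> 'a) \<Rightarrow>
   ('a \<Rightarrow> 'a \<Rightarrow> 'a) \<Rightarrow> ('a \<Rightarrow> 'a \<Rightarrow> 'a) \<Rightarrow> ('a \<Rightarrow> 'a \<Rightarrow> 'a) \<Rightarrow>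
   (real \<Rightarrow> 'a) \<Rightarrow> (real \<Rightarrow> 'a) \<Rightarrow> (nat \<Rightarrow> 'a) \<Rightarrow>
   (real \<times> real \<times> nat \<Rightarrow> 'a) \<Rightarrow> (real \<times> real \<times> nat \<Rightarrow> 'a) \<Rightarrow> (real \<times> real \<times> nat \<Rightarrow> 'a) \<Rightarrow> bool" where
  "solves_discrete_Goursat \<epsilon> \<rho> R f g u v \<xi> \<eta> a0 b0 \<theta>0 a b \<theta> \<longleftrightarrow>
    (\<forall>(x, y, z) \<in> Omega_grid \<epsilon> \<rho> R.
      (x + \<epsilon> \<le> \<rho> \<longrightarrow>
        (b (x + \<epsilon>, y, z) - b (x, y, z)) /\<^sub>R \<epsilon> = g (a (x, y, z)) (b (x, y, z)) \<and>
        (\<theta> (x + \<epsilon>, y, z) - \<theta> (x, y, z)) /\<^sub>R \<epsilon> = u (a (x, y, z)) (\<theta> (x, y, z))) \<and>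
      (y + \<epsilon> \<le> \<rho> \<longrightarrow>
        (a (x, y + \<epsilon>, z) - a (x, y, z)) /\<^sub>R \<epsilon> = f (a (x, y, z)) (b (x, y, z)) \<and>
        (\<theta> (x, y + \<epsilon>, z) - \<theta> (x, y, z)) /\<^sub>R \<epsilon> = v (b (x, y, z)) (\<theta> (x, y, z))) \<and>
      (z < R \<longrightarrow>
        a (x, y, z + 1) - a (x, y, z) = \<xi> (a (x, y, z)) (\<theta> (x, y, z)) \<and>
        b (x, y, z + 1) - b (x, y, z) = \<eta> (b (x, y, z)) (\<theta> (x, y, z)))) \<and>
    (\<forall>x\<in>grid \<epsilon> \<rho>. a (x, 0, 0) = a0 x) \<and>
    (\<forall>y\<in>grid \<epsilon> \<rho>. b (0, y, 0) = b0 y) \<and>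
    (\<forall>z\<in>{0..R}. \<theta> (0, 0, z) = \<theta>0 z)"


section \<open>Approximation and limits\<close>

definition C1_approximates ::
  "real set \<Rightarrow> (real \<Rightarrow> 'a::real_normed_vector \<Rightarrow> 'b::real_normed_vector \<Rightarrow> 'c::real_normed_vector) \<Rightarrow>
   ('a \<Rightarrow> 'b \<Rightarrow> 'c) \<Rightarrow> bool" where
  "C1_approximates E F\<epsilon> F \<longleftrightarrow>
    (\<forall>B. bounded B \<longrightarrow>
      (\<exists>C. \<forall>\<epsilon>\<in>E. \<forall>(p, q)\<in>B.
        norm (F\<epsilon> \<epsilon> p q - F p q) \<le> C * \<epsilon> \<and>
        onorm (\<lambda>h. D1 (F\<epsilon> \<epsilon>) p q h - D1 F p q h) \<le> C * \<epsilon> \<and>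
        onorm (\<lambda>h. D2 (F\<epsilon> \<epsilon>) p q h - D2 F p q h) \<le> C * \<epsilon>))"

text \<open>
  As \<open>z\<close> takes finitely many values and the squares are bounded, Lipschitz continuity in
  \<open>(x, y)\<close>, uniformly in \<open>z\<close>, is the same as Lipschitz continuity on \<open>Omega \<rho> R\<close> as a
  subset of three-dimensional space.
\<close>

definition Lipschitz_on_Omega ::
  "real \<Rightarrow> nat \<Rightarrow> (real \<times> real \<times> nat \<Rightarrow> 'a::real_normed_vector) \<Rightarrow> bool" where
  "Lipschitz_on_Omega \<rho> R p \<longleftrightarrow>
    (\<exists>L. \<forall>z\<in>{0..R}. L-lipschitz_on ({0..\<rho>} \<times> {0..\<rho>}) (\<lambda>(x, y). p (x, y, z)))"

end

theory Submission
  imports Defs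
begin

text \<open>
  Up to a defect of order \<open>\<epsilon>\<close>, the discrete solutions satisfy the explicit Euler scheme for
  \<open>f, g, u, v, \<xi>, \<eta>\<close> in all coordinate directions. By a discrete
  Gronwall argument along the diagonals \<open>i + j = const\<close>, two such grid functions differ by a multiple of the
  defect and of the difference of their Goursat data. Comparing a solution with its own shift by one mesh
  step gives Lipschitz bounds uniform in \<open>\<epsilon>\<close>; with these, the solution for \<open>\<epsilon>/2\<close> restricted to the coarse grid is
  again an approximate solution for \<open>\<epsilon>\<close>, so that consecutive solutions differ by \<open>O(\<epsilon>)\<close>
  and form a Cauchy sequence. All the equations pass to the limit.
  The domain is shrunk because a \<open>C\<^sup>1\<close> map on a
  Banach space is in general bounded and Lipschitz only near a point: on a small square the layer \<open>z\<close> of the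
  solutions stays close to its value at the corner.
\<close>

text \<open>The estimates are circular: size and Lipschitz constant of the right-hand sides are
  controlled only in balls around base points, while staying in these balls is itself a consequence
  of the estimates. The circle is broken by demanding the Euler equations (\<open>defect\<close>)
  only at points already inside the balls. The approximation hypothesis is then used on bounded sets
  only, and invariance of the balls comes out of the same step-by-step induction that measures
  growth (\<open>growth_bound\<close>). Steps in z have length 1, so \<xi> and \<eta> displace a and
  b by amounts that do not shrink with the mesh. Hence every layer has its own base points, and
  estimates pass from layer to layer: layer z supplies the axis data of a and b on layer z+1, while
  the corner value of \<theta> is prescribed on every layer. Constants grow with each layer, which
  is harmless for finitely many z. The differential equations are not derived through integral
  equations: a quadratic remainder estimate on the grid survives the limit and yields the derivative
  directly.\<close>

section \<open>Comparison of approximate discrete solutions\<close>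

text \<open>Abstract pattern of the Goursat problem: \<alpha> propagates in y from the x-axis,
  \<beta> in x from the y-axis, \<gamma> in either direction from the corner, so each value is
  reached from the preceding diagonal. The majorant \<open>W\<close> is left free: it is exponential
  for differences of solutions and linear for distances to a base point.\<close>

lemma grid_bound:
  fixes \<alpha> \<beta> \<gamma> :: "nat \<Rightarrow> nat \<Rightarrow> real" and W :: "nat \<Rightarrow> real"
  assumes init: "\<And>i. i \<le> N \<Longrightarrow> \<alpha> i 0 \<le> W i" "\<And>j. j \<le> M \<Longrightarrow> \<beta> 0 j \<le> W j" "\<gamma> 0 0 \<le> W 0"
    and y: "\<And>i j. \<lbrakk>i \<le> N; j < M; \<alpha> i j \<le> W (i + j); \<beta> i j \<le> W (i + j); \<gamma> i j \<le> W (i + j)\<rbrakk>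
        \<Longrightarrow> \<alpha> i (Suc j) \<le> W (Suc (i + j)) \<and> \<gamma> i (Suc j) \<le> W (Suc (i + j))"
    and x: "\<And>i j. \<lbrakk>i < N; j \<le> M; \<alpha> i j \<le> W (i + j); \<beta> i j \<le> W (i + j); \<gamma> i j \<le> W (i + j)\<rbrakk>
        \<Longrightarrow> \<beta> (Suc i) j \<le> W (Suc (i + j)) \<and> \<gamma> (Suc i) j \<le> W (Suc (i + j))"
    and "i \<le> N" "j \<le> M"
  shows "\<alpha> i j \<le> W (i + j) \<and> \<beta> i j \<le> W (i + j) \<and> \<gamma> i j \<le> W (i + j)"
  using \<open>i \<le> N\<close> \<open>j \<le> M\<close>
proof (induction "i + j" arbitrary: i j rule: less_induct)
  case less
  have y': "\<alpha> i j \<le> W (i + j) \<and> \<gamma> i j \<le> W (i + j)" if "j = Suc j'" for j'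
    using y[of i j'] less.hyps[of i j'] less.prems that by simp
  have x': "\<beta> i j \<le> W (i + j) \<and> \<gamma> i j \<le> W (i + j)" if "i = Suc i'" for i'
    using x[of i' j] less.hyps[of i' j] less.prems that by simp
  have "\<alpha> i j \<le> W (i + j)"
    using y' init(1)[OF less.prems(1)] by (cases j) auto
  moreover have "\<beta> i j \<le> W (i + j)"
    using x' init(2)[OF less.prems(2)] by (cases i) auto
  moreover have "\<gamma> i j \<le> W (i + j)"
    using x' y' init(3) by (cases i; cases j) auto
  ultimately show ?case by blast
qed

text \<open>What continuous differentiability gives near a point. Size and slope share one constant
  so that a single number can serve all right-hand sides.\<close>

definition controlled :: "real \<Rightarrow> 'a::real_normed_vector set \<Rightarrow> 'b::real_normed_vector set \<Rightarrow>
    ('a \<Rightarrow> 'b \<Rightarrow> 'c::real_normed_vector) \<Rightarrow> bool" where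
  "controlled K S S' F \<longleftrightarrow> (\<forall>p\<in>S. \<forall>q\<in>S'. norm (F p q) \<le> K) \<and>
    (\<forall>p\<in>S. \<forall>p'\<in>S. \<forall>q\<in>S'. \<forall>q'\<in>S'. norm (F p q - F p' q') \<le> K * (norm (p - p') + norm (q - q')))"

lemma controlled_bound: "controlled K S S' F \<Longrightarrow> p \<in> S \<Longrightarrow> q \<in> S' \<Longrightarrow> norm (F p q) \<le> K"
  by (simp add: controlled_def)

lemma controlled_lipschitz:
  "controlled K S S' F \<Longrightarrow> p \<in> S \<Longrightarrow> p' \<in> S \<Longrightarrow> q \<in> S' \<Longrightarrow> q' \<in> S' \<Longrightarrow>
    norm (F p q - F p' q') \<le> K * (norm (p - p') + norm (q - q'))"
  by (simp add: controlled_def)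

lemma controlled_lipschitz_le:
  assumes "controlled K S S' F" "p \<in> S" "p' \<in> S" "q \<in> S'" "q' \<in> S'" "0 \<le> K"
    and "norm (p - p') \<le> w" "norm (q - q') \<le> w"
  shows "norm (F p q - F p' q') \<le> 2 * K * w"
proof -
  have "norm (F p q - F p' q') \<le> K * (norm (p - p') + norm (q - q'))"
    using assms by (intro controlled_lipschitz)
  also have "\<dots> \<le> K * (w + w)"
    using assms by (intro mult_left_mono add_mono)
  finally show ?thesis by simp
qed

text \<open>One Gronwall step: the two defects, the old difference, and the change of
  \<open>F\<close>. The advanced unknown \<open>x\<close> is kept apart from \<open>p\<close> and
  \<open>q\<close> because it sits in the first argument of some right-hand sides and in the second
  of others. The choice \<open>e = 1\<close> covers steps in z.\<close>

lemma step_difference: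
  fixes x x' x1 x1' :: "'a::real_normed_vector"
  assumes F: "controlled K S S' F" "p \<in> S" "p' \<in> S" "q \<in> S'" "q' \<in> S'" "0 \<le> K"
    and d: "norm (x1 - x - e *\<^sub>R F p q) \<le> e * D" "norm (x1' - x' - e *\<^sub>R F p' q') \<le> e * D"
    and w: "norm (x - x') \<le> w" "norm (p - p') \<le> w" "norm (q - q') \<le> w" and e: "0 \<le> e"
  shows "norm (x1 - x1') \<le> w + e * (2 * K * w + 2 * D)"
proof -
  have "norm (F p q - F p' q') \<le> 2 * K * w"
    using F w by (intro controlled_lipschitz_le)
  then have l: "norm (e *\<^sub>R (F p q - F p' q')) \<le> e * (2 * K * w)"
    using e by (simp add: mult_left_mono)
  have eq: "x1 - x1' = (x1 - x - e *\<^sub>R F p q) - (x1' - x' - e *\<^sub>R F p' q') + (x - x') + e *\<^sub>R (F p q - F p' q')"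
    by (simp add: scaleR_diff_right)
  have "norm (x1 - x1') \<le> (e * D + e * D) + w + e * (2 * K * w)"
    unfolding eq
    by (intro norm_triangle_mono order_trans[OF norm_triangle_ineq4 add_mono[OF d]] w(1) l order_refl)
  then show ?thesis by (simp add: algebra_simps)
qed

lemma step_bound:
  fixes x x1 :: "'a::real_normed_vector"
  assumes "norm (x1 - x - e *\<^sub>R F) \<le> e * D" "norm F \<le> K" "0 \<le> e"
  shows "norm (x1 - x) \<le> e * (K + D)"
proof -
  have "norm (x1 - x) \<le> norm (x1 - x - e *\<^sub>R F) + norm (e *\<^sub>R F)"
    using norm_triangle_ineq[of "x1 - x - e *\<^sub>R F" "e *\<^sub>R F"] by simp
  also have "\<dots> \<le> e * D + e * K"
    using assms by (intro add_mono) (simp_all add: mult_left_mono)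
  finally show ?thesis by (simp add: algebra_simps)
qed

text \<open>The sets stay arbitrary here, since comparison uses nothing but the control on them;
  they become balls when invariance is proved.\<close>

locale layered_system =
  fixes f g u v \<xi> \<eta> :: "'a::real_normed_vector \<Rightarrow> 'a \<Rightarrow> 'a"
    and SA SB ST :: "nat \<Rightarrow> 'a set" and R :: nat and K :: real
  assumes K: "0 \<le> K"
    and controlled:
      "z \<le> R \<Longrightarrow> controlled K (SA z) (SB z) f" "z \<le> R \<Longrightarrow> controlled K (SA z) (SB z) g"
      "z \<le> R \<Longrightarrow> controlled K (SA z) (ST z) u" "z \<le> R \<Longrightarrow> controlled K (SB z) (ST z) v"
      "z \<le> R \<Longrightarrow> controlled K (SA z) (ST z) \<xi>" "z \<le> R \<Longrightarrow> controlled K (SB z) (ST z) \<eta>"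
begin

definition inside :: "(nat \<Rightarrow> nat \<Rightarrow> nat \<Rightarrow> 'a) \<Rightarrow> (nat \<Rightarrow> nat \<Rightarrow> nat \<Rightarrow> 'a) \<Rightarrow> (nat \<Rightarrow> nat \<Rightarrow> nat \<Rightarrow> 'a) \<Rightarrow> nat \<Rightarrow> nat \<Rightarrow> nat \<Rightarrow> bool" where
  "inside A B T i j z \<longleftrightarrow> A i j z \<in> SA z \<and> B i j z \<in> SB z \<and> T i j z \<in> ST z"

text \<open>The premise \<open>inside\<close> allows this to be claimed before it is known where the
  grid functions take their values. Steps in x and y have length \<open>e\<close> and carry an error
  \<open>e * D\<close>; steps in z have length 1 and carry \<open>D\<close>.\<close>

definition defect :: "real \<Rightarrow> real \<Rightarrow> nat \<Rightarrow> nat \<Rightarrow> (nat \<Rightarrow> nat \<Rightarrow> nat \<Rightarrow> 'a) \<Rightarrow> (nat \<Rightarrow> nat \<Rightarrow> nat \<Rightarrow> 'a) \<Rightarrow> (nat \<Rightarrow> nat \<Rightarrow> nat \<Rightarrow> 'a) \<Rightarrow> bool" where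
  "defect e D N M A B T \<longleftrightarrow> (\<forall>i\<le>N. \<forall>j\<le>M. \<forall>z\<le>R. inside A B T i j z \<longrightarrow>
    (j < M \<longrightarrow>
      norm (A i (Suc j) z - A i j z - e *\<^sub>R f (A i j z) (B i j z)) \<le> e * D \<and>
      norm (T i (Suc j) z - T i j z - e *\<^sub>R v (B i j z) (T i j z)) \<le> e * D) \<and>
    (i < N \<longrightarrow>
      norm (B (Suc i) j z - B i j z - e *\<^sub>R g (A i j z) (B i j z)) \<le> e * D \<and>
      norm (T (Suc i) j z - T i j z - e *\<^sub>R u (A i j z) (T i j z)) \<le> e * D) \<and>
    (z < R \<longrightarrow>
      norm (A i j (Suc z) - A i j z - \<xi> (A i j z) (T i j z)) \<le> D \<and>
      norm (B i j (Suc z) - B i j z - \<eta> (B i j z) (T i j z)) \<le> D))"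

definition all_inside :: "nat \<Rightarrow> nat \<Rightarrow> (nat \<Rightarrow> nat \<Rightarrow> nat \<Rightarrow> 'a) \<Rightarrow> (nat \<Rightarrow> nat \<Rightarrow> nat \<Rightarrow> 'a) \<Rightarrow> (nat \<Rightarrow> nat \<Rightarrow> nat \<Rightarrow> 'a) \<Rightarrow> bool" where
  "all_inside N M A B T \<longleftrightarrow> (\<forall>i\<le>N. \<forall>j\<le>M. \<forall>z\<le>R. inside A B T i j z)"

definition close_at :: "real \<Rightarrow> (nat \<Rightarrow> nat \<Rightarrow> nat \<Rightarrow> 'a) \<Rightarrow> (nat \<Rightarrow> nat \<Rightarrow> nat \<Rightarrow> 'a) \<Rightarrow> (nat \<Rightarrow> nat \<Rightarrow> nat \<Rightarrow> 'a) \<Rightarrow> (nat \<Rightarrow> nat \<Rightarrow> nat \<Rightarrow> 'a) \<Rightarrow> (nat \<Rightarrow> nat \<Rightarrow> nat \<Rightarrow> 'a) \<Rightarrow> (nat \<Rightarrow> nat \<Rightarrow> nat \<Rightarrow> 'a) \<Rightarrow> nat \<Rightarrow> nat \<Rightarrow> nat \<Rightarrow> bool" where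
  "close_at c A B T A' B' T' i j z \<longleftrightarrow>
    norm (A i j z - A' i j z) \<le> c \<and> norm (B i j z - B' i j z) \<le> c \<and> norm (T i j z - T' i j z) \<le> c"

text \<open>The factors \<open>1\<close> in the last two clauses present a z-step as a step of
  length 1, the shape that \<open>step_difference\<close> expects.\<close>

lemma defectD:
  assumes "defect e D N M A B T" "inside A B T i j z" "i \<le> N" "j \<le> M" "z \<le> R"
  shows "j < M \<Longrightarrow> norm (A i (Suc j) z - A i j z - e *\<^sub>R f (A i j z) (B i j z)) \<le> e * D"
    and "j < M \<Longrightarrow> norm (T i (Suc j) z - T i j z - e *\<^sub>R v (B i j z) (T i j z)) \<le> e * D"
    and "i < N \<Longrightarrow> norm (B (Suc i) j z - B i j z - e *\<^sub>R g (A i j z) (B i j z)) \<le> e * D"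
    and "i < N \<Longrightarrow> norm (T (Suc i) j z - T i j z - e *\<^sub>R u (A i j z) (T i j z)) \<le> e * D"
    and "z < R \<Longrightarrow> norm (A i j (Suc z) - A i j z - 1 *\<^sub>R \<xi> (A i j z) (T i j z)) \<le> 1 * D"
    and "z < R \<Longrightarrow> norm (B i j (Suc z) - B i j z - 1 *\<^sub>R \<eta> (B i j z) (T i j z)) \<le> 1 * D"
  using assms unfolding defect_def by simp_all

lemma defect_mono:
  assumes "defect e D N M A B T" "D \<le> D'" "0 \<le> e"
  shows "defect e D' N M A B T"
proof -
  have "e * D \<le> e * D'" using assms by (simp add: mult_left_mono)
  then show ?thesis using assms(1,2) unfolding defect_def by (meson order_trans)
qed

text \<open>Discrete Gronwall inside one layer: one growth factor per step, along paths of total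
  length at most 2.\<close>

lemma compare_layer:
  assumes def: "defect e D N M A B T" "defect e D N M A' B' T'"
    and ins: "all_inside N M A B T" "all_inside N M A' B' T'"
    and e: "0 \<le> e" "e * N \<le> 1" "e * M \<le> 1" and D: "0 \<le> D" and E: "0 \<le> E" and z: "z \<le> R"
    and init: "\<And>i. i \<le> N \<Longrightarrow> norm (A i 0 z - A' i 0 z) \<le> E"
      "\<And>j. j \<le> M \<Longrightarrow> norm (B 0 j z - B' 0 j z) \<le> E" "norm (T 0 0 z - T' 0 0 z) \<le> E"
    and ij: "i \<le> N" "j \<le> M"
  shows "close_at ((E + 2 * D) * exp (4 * K + 2)) A B T A' B' T' i j z"
proof -
  \<comment> \<open>\<open>2 * K\<close> is the Lipschitz growth when both arguments vary; the extra
    1 absorbs the defects, because \<open>2 * D \<le> W n\<close> thanks to the initial factor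
    \<open>E + 2 * D\<close>.\<close>
  define q where "q = 1 + e * (2 * K + 1)"
  have q: "1 \<le> q" unfolding q_def using K e by simp
  define W where "W n = (E + 2 * D) * q ^ n" for n :: nat
  have W0: "E \<le> W n" for n
  proof -
    have "(E + 2 * D) * 1 \<le> W n" unfolding W_def
      using E D q by (intro mult_left_mono one_le_power) auto
    then show ?thesis using D by simp
  qed
  have D_W: "2 * D \<le> W n" for n
  proof -
    have "(E + 2 * D) * 1 \<le> W n" unfolding W_def
      using E D q by (intro mult_left_mono one_le_power) auto
    then show ?thesis using E by simp
  qed
  have W_step: "W n + e * (2 * K * W n + 2 * D) \<le> W (Suc n)" for n
  proof -
    have "W (Suc n) = W n + e * (2 * K * W n + W n)"
      unfolding W_def q_def by (simp add: algebra_simps)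
    moreover have "e * (2 * K * W n + 2 * D) \<le> e * (2 * K * W n + W n)"
      using D_W e by (intro mult_left_mono) auto
    ultimately show ?thesis by simp
  qed
  have ins': "inside A B T i j z" "inside A' B' T' i j z" if "i \<le> N" "j \<le> M" for i j
    using ins that z by (auto simp: all_inside_def)
  have c: "norm (A i j z - A' i j z) \<le> W (i + j) \<and> norm (B i j z - B' i j z) \<le> W (i + j) \<and>
      norm (T i j z - T' i j z) \<le> W (i + j)"
  proof (rule grid_bound[where N = N and M = M])
    fix i j assume ij: "i \<le> N" "j < M" and w: "norm (A i j z - A' i j z) \<le> W (i + j)"
      "norm (B i j z - B' i j z) \<le> W (i + j)" "norm (T i j z - T' i j z) \<le> W (i + j)"
    have I: "inside A B T i j z" "inside A' B' T' i j z" using ins' ij by auto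
    then have S: "A i j z \<in> SA z" "A' i j z \<in> SA z" "B i j z \<in> SB z" "B' i j z \<in> SB z"
      "T i j z \<in> ST z" "T' i j z \<in> ST z" by (auto simp: inside_def)
    have "norm (A i (Suc j) z - A' i (Suc j) z) \<le> W (i + j) + e * (2 * K * W (i + j) + 2 * D)"
      using defectD(1)[OF def(1) I(1)] defectD(1)[OF def(2) I(2)] ij z
      by (intro step_difference[OF controlled(1)[OF z] S(1-4) K _ _ w(1,1,2) e(1)]) auto
    moreover have "norm (T i (Suc j) z - T' i (Suc j) z) \<le> W (i + j) + e * (2 * K * W (i + j) + 2 * D)"
      using defectD(2)[OF def(1) I(1)] defectD(2)[OF def(2) I(2)] ij z
      by (intro step_difference[OF controlled(4)[OF z] S(3-6) K _ _ w(3,2,3) e(1)]) auto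
    ultimately show "norm (A i (Suc j) z - A' i (Suc j) z) \<le> W (Suc (i + j)) \<and>
        norm (T i (Suc j) z - T' i (Suc j) z) \<le> W (Suc (i + j))"
      using W_step[of "i + j"] by simp
  next
    fix i j assume ij: "i < N" "j \<le> M" and w: "norm (A i j z - A' i j z) \<le> W (i + j)"
      "norm (B i j z - B' i j z) \<le> W (i + j)" "norm (T i j z - T' i j z) \<le> W (i + j)"
    have I: "inside A B T i j z" "inside A' B' T' i j z" using ins' ij by auto
    then have S: "A i j z \<in> SA z" "A' i j z \<in> SA z" "B i j z \<in> SB z" "B' i j z \<in> SB z"
      "T i j z \<in> ST z" "T' i j z \<in> ST z" by (auto simp: inside_def)
    have "norm (B (Suc i) j z - B' (Suc i) j z) \<le> W (i + j) + e * (2 * K * W (i + j) + 2 * D)"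
      using defectD(3)[OF def(1) I(1)] defectD(3)[OF def(2) I(2)] ij z
      by (intro step_difference[OF controlled(2)[OF z] S(1-4) K _ _ w(2,1,2) e(1)]) auto
    moreover have "norm (T (Suc i) j z - T' (Suc i) j z) \<le> W (i + j) + e * (2 * K * W (i + j) + 2 * D)"
      using defectD(4)[OF def(1) I(1)] defectD(4)[OF def(2) I(2)] ij z
      by (intro step_difference[OF controlled(3)[OF z] S(1,2,5,6) K _ _ w(3,1,3) e(1)]) auto
    ultimately show "norm (B (Suc i) j z - B' (Suc i) j z) \<le> W (Suc (i + j)) \<and>
        norm (T (Suc i) j z - T' (Suc i) j z) \<le> W (Suc (i + j))"
      using W_step[of "i + j"] by simp
  qed (use init W0 ij in \<open>auto intro: order_trans\<close>)
  \<comment> \<open>By \<open>1 + s \<le> exp s\<close> the powers become an exponential, and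
    \<open>e * (i + j) \<le> 2\<close> makes its exponent independent of the mesh.\<close>
  have "q ^ (i + j) \<le> exp (e * (2 * K + 1)) ^ (i + j)"
    using q by (intro power_mono) (auto simp: q_def)
  also have "\<dots> = exp ((e * i + e * j) * (2 * K + 1))"
    by (simp add: exp_of_nat_mult[symmetric] algebra_simps)
  also have "\<dots> \<le> exp (2 * (2 * K + 1))"
  proof -
    have "e * i \<le> e * N" "e * j \<le> e * M" using ij e by (auto intro!: mult_left_mono)
    then have "e * i + e * j \<le> 2" using e by linarith
    then have "(e * i + e * j) * (2 * K + 1) \<le> 2 * (2 * K + 1)" using K by (intro mult_right_mono) auto
    then show ?thesis by simp
  qed
  finally have "W (i + j) \<le> (E + 2 * D) * exp (4 * K + 2)"
    unfolding W_def using E D by (intro mult_left_mono) (auto simp: algebra_simps)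
  with c show ?thesis unfolding close_at_def by linarith
qed

text \<open>\<open>G\<close> is fixed before the step length, the defect and the grid, which is what
  uniformity in the mesh size means. \<open>N\<close> and \<open>M\<close> may differ because a
  shifted solution loses a row in one direction only.\<close>

definition comparison_factor where
  "comparison_factor n G \<longleftrightarrow> 0 \<le> G \<and> (\<forall>e D N M A B T A' B' T'.
    defect e D N M A B T \<longrightarrow> defect e D N M A' B' T' \<longrightarrow>
    all_inside N M A B T \<longrightarrow> all_inside N M A' B' T' \<longrightarrow>
    0 \<le> e \<longrightarrow> e * real N \<le> 1 \<longrightarrow> e * real M \<le> 1 \<longrightarrow> 0 \<le> D \<longrightarrow>
    (\<forall>i\<le>N. norm (A i 0 0 - A' i 0 0) \<le> D) \<longrightarrow> (\<forall>j\<le>M. norm (B 0 j 0 - B' 0 j 0) \<le> D) \<longrightarrow>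
    (\<forall>z\<le>R. norm (T 0 0 z - T' 0 0 z) \<le> D) \<longrightarrow>
    (\<forall>i\<le>N. \<forall>j\<le>M. \<forall>z\<le>n. close_at (G * D) A B T A' B' T' i j z))"

lemma comparison_factor_0: "comparison_factor 0 (3 * exp (4 * K + 2))"
  unfolding comparison_factor_def
proof (intro conjI allI impI)
  fix e D N M A B T A' B' T' i j and z :: nat
  assume *: "defect e D N M A B T" "defect e D N M A' B' T'"
    "all_inside N M A B T" "all_inside N M A' B' T'"
    "0 \<le> e" "e * real N \<le> 1" "e * real M \<le> 1" "0 \<le> D"
    "\<forall>i\<le>N. norm (A i 0 0 - A' i 0 0) \<le> D" "\<forall>j\<le>M. norm (B 0 j 0 - B' 0 j 0) \<le> D"
    "\<forall>z\<le>R. norm (T 0 0 z - T' 0 0 z) \<le> D" "i \<le> N" "j \<le> M" "z \<le> 0"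
  have "close_at ((D + 2 * D) * exp (4 * K + 2)) A B T A' B' T' i j 0"
    by (rule compare_layer[OF *(1-8)]) (use * in auto)
  then show "close_at (3 * exp (4 * K + 2) * D) A B T A' B' T' i j z"
    using * by (simp add: mult_ac)
qed simp

text \<open>The z-step turns closeness on layer \<open>n\<close> into closeness of the axis data on
  the next layer, to which the one-layer comparison applies.\<close>

lemma comparison_factor_Suc:
  assumes G_factor: "comparison_factor n G" and nR: "n < R"
  shows "\<exists>G'. comparison_factor (Suc n) G'"
proof -
  have G: "0 \<le> G" using G_factor by (simp add: comparison_factor_def)
  note G_close = G_factor[unfolded comparison_factor_def, THEN conjunct2, rule_format]
  \<comment> \<open>\<open>E * D\<close> bounds the data of the new layer:
    \<open>(1 + 2 * K) * G\<close> is the old difference sent through \<xi> or \<eta>, two further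
    \<open>D\<close> are the defects of the z-steps, and \<open>1 \<le> E\<close> covers the
    prescribed corner value of \<open>T\<close>. The maximum in \<open>G'\<close> keeps the earlier
    layers covered.\<close>
  define E where "E = (1 + 2 * K) * G + 3"
  define G' where "G' = max G ((E + 2) * exp (4 * K + 2))"
  have E: "1 \<le> E" using K G by (simp add: E_def)
  have "comparison_factor (Suc n) G'"
    unfolding comparison_factor_def
  proof (intro conjI allI impI)
    show "0 \<le> G'" using G by (simp add: G'_def)
    fix e D N M A B T A' B' T' i j and z :: nat
    assume *: "defect e D N M A B T" "defect e D N M A' B' T'"
      "all_inside N M A B T" "all_inside N M A' B' T'"
      "0 \<le> e" "e * real N \<le> 1" "e * real M \<le> 1" "0 \<le> D"
      and **: "\<forall>i\<le>N. norm (A i 0 0 - A' i 0 0) \<le> D" "\<forall>j\<le>M. norm (B 0 j 0 - B' 0 j 0) \<le> D"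
      "\<forall>z\<le>R. norm (T 0 0 z - T' 0 0 z) \<le> D" and ijz: "i \<le> N" "j \<le> M" "z \<le> Suc n"
    have close: "close_at (G * D) A B T A' B' T' i j z" if "i \<le> N" "j \<le> M" "z \<le> n" for i j z
      by (rule G_close[OF * _ _ _ that]) (use ** in auto)
    have E_D: "D \<le> E * D" using mult_right_mono[OF E *(8)] by simp
    show "close_at (G' * D) A B T A' B' T' i j z"
    proof (cases "z = Suc n")
      case False
      have "G * D \<le> G' * D" using *(8) by (simp add: G'_def mult_right_mono)
      then show ?thesis using close[OF ijz(1,2), of z] ijz False unfolding close_at_def by simp
    next
      case z: True
      have nR: "n < R" "n \<le> R" using nR by auto
      have ax: "norm (A i j (Suc n) - A' i j (Suc n)) \<le> E * D \<and> norm (B i j (Suc n) - B' i j (Suc n)) \<le> E * D"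
        if ij: "i \<le> N" "j \<le> M" for i j
      proof -
        have I: "inside A B T i j n" "inside A' B' T' i j n" using *(3,4) ij nR by (auto simp: all_inside_def)
        then have S: "A i j n \<in> SA n" "A' i j n \<in> SA n" "B i j n \<in> SB n" "B' i j n \<in> SB n"
          "T i j n \<in> ST n" "T' i j n \<in> ST n" by (auto simp: inside_def)
        have w: "norm (A i j n - A' i j n) \<le> G * D" "norm (B i j n - B' i j n) \<le> G * D"
          "norm (T i j n - T' i j n) \<le> G * D" using close[OF ij, of n] by (auto simp: close_at_def)
        have "norm (A i j (Suc n) - A' i j (Suc n)) \<le> G * D + 1 * (2 * K * (G * D) + 2 * D)"
          by (rule step_difference[where e = 1, OF controlled(5)[OF nR(2)] S(1,2,5,6) K
              defectD(5)[OF *(1) I(1) ij nR(2,1)] defectD(5)[OF *(2) I(2) ij nR(2,1)] w(1,1,3)]) simp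
        moreover have "norm (B i j (Suc n) - B' i j (Suc n)) \<le> G * D + 1 * (2 * K * (G * D) + 2 * D)"
          by (rule step_difference[where e = 1, OF controlled(6)[OF nR(2)] S(3-6) K
              defectD(6)[OF *(1) I(1) ij nR(2,1)] defectD(6)[OF *(2) I(2) ij nR(2,1)] w(2,2,3)]) simp
        moreover have "G * D + 1 * (2 * K * (G * D) + 2 * D) \<le> E * D"
          using *(8) by (simp add: E_def algebra_simps)
        ultimately show ?thesis by linarith
      qed
      have "norm (T 0 0 (Suc n) - T' 0 0 (Suc n)) \<le> E * D"
        using **(3) E_D nR by (meson Suc_leI order_trans)
      then have "close_at ((E * D + 2 * D) * exp (4 * K + 2)) A B T A' B' T' i j (Suc n)"
        by (intro compare_layer[OF *]) (use ax *(8) E nR ijz in auto)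
      moreover have "(E * D + 2 * D) * exp (4 * K + 2) = ((E + 2) * exp (4 * K + 2)) * D"
        by (simp add: algebra_simps)
      moreover have "\<dots> \<le> G' * D"
        using *(8) by (intro mult_right_mono) (auto simp: G'_def)
      ultimately show ?thesis unfolding z close_at_def by simp
    qed
  qed
  then show ?thesis by blast
qed

lemma ex_comparison_factor: "n \<le> R \<Longrightarrow> \<exists>G. comparison_factor n G"
proof (induction n)
  case 0
  then show ?case using comparison_factor_0 by blast
next
  case (Suc n)
  then show ?case using comparison_factor_Suc[of n] by auto
qed

lemma comparison_factorD:
  assumes "comparison_factor R G" "defect e D N M A B T" "defect e D N M A' B' T'"
    "all_inside N M A B T" "all_inside N M A' B' T'"
    "0 \<le> e" "e * real N \<le> 1" "e * real M \<le> 1" "0 \<le> D"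
    "\<And>i. i \<le> N \<Longrightarrow> norm (A i 0 0 - A' i 0 0) \<le> D" "\<And>j. j \<le> M \<Longrightarrow> norm (B 0 j 0 - B' 0 j 0) \<le> D"
    "\<And>z. z \<le> R \<Longrightarrow> norm (T 0 0 z - T' 0 0 z) \<le> D" "i \<le> N" "j \<le> M" "z \<le> R"
  shows "close_at (G * D) A B T A' B' T' i j z"
  by (rule assms(1)[unfolded comparison_factor_def, THEN conjunct2, rule_format,
      OF assms(2-9) _ _ _ assms(13-15)]) (use assms in auto)

end

section \<open>Limits of functions on dyadic grids\<close>

abbreviation mesh :: "nat \<Rightarrow> real" where "mesh k \<equiv> (1/2) ^ k"

lemma mesh_pos: "0 < mesh k"
  by simp

lemma nonneg_if_mesh: "0 \<le> c * mesh k \<Longrightarrow> 0 \<le> c"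
  using mesh_pos[of k] by (metis zero_le_mult_iff not_le)

text \<open>For \<open>0 \<le> x\<close>, the index of the last grid point not beyond
  \<open>x\<close>. Rounding down allows levels to be compared at arbitrary real points.\<close>

definition idx :: "nat \<Rightarrow> real \<Rightarrow> nat" where
  "idx k x = nat \<lfloor>x * 2 ^ k\<rfloor>"

text \<open>Origin of the index bounds \<open>2^(k-m)\<close> everywhere below: that many steps of
  length \<open>mesh k\<close> span the side \<open>mesh m\<close>.\<close>

lemma mesh_mult_power: "m \<le> k \<Longrightarrow> mesh k * 2 ^ (k - m) = mesh m"
  by (simp add: power_one_over power_diff field_simps)

lemma idx_bounds:
  assumes "0 \<le> x"
  shows "mesh k * idx k x \<le> x" "x < mesh k * idx k x + mesh k"
proof -
  have i: "real (idx k x) = of_int \<lfloor>x * 2 ^ k\<rfloor>"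
    using assms by (simp add: idx_def)
  have "real (idx k x) \<le> x * 2 ^ k" "x * 2 ^ k < real (idx k x) + 1"
    unfolding i by linarith+
  then show "mesh k * idx k x \<le> x" "x < mesh k * idx k x + mesh k"
    by (simp_all add: power_one_over field_simps)
qed

lemma idx_mesh: "idx k (mesh k * real i) = i"
  by (simp add: idx_def power_one_over)

lemma idx_mono: "x \<le> y \<Longrightarrow> idx k x \<le> idx k y"
  unfolding idx_def by (intro nat_mono floor_mono mult_right_mono) auto

lemma idx_le:
  assumes "m \<le> k" "x \<le> mesh m"
  shows "idx k x \<le> 2 ^ (k - m)"
proof -
  have "idx k x \<le> idx k (mesh k * real (2 ^ (k - m)))"
    using assms by (intro idx_mono) (simp add: mesh_mult_power)
  then show ?thesis by (simp only: idx_mesh)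
qed

text \<open>Halving the mesh appends one binary digit to the index.\<close>

lemma idx_Suc:
  assumes "0 \<le> x"
  shows "idx (Suc k) x = 2 * idx k x \<or> idx (Suc k) x = Suc (2 * idx k x)"
proof -
  define w where "w = x * 2 ^ k"
  have "\<lfloor>2 * w\<rfloor> = 2 * \<lfloor>w\<rfloor> \<or> \<lfloor>2 * w\<rfloor> = 2 * \<lfloor>w\<rfloor> + 1" by linarith
  moreover have "0 \<le> \<lfloor>w\<rfloor>" using assms by (simp add: w_def)
  moreover have "x * 2 ^ Suc k = 2 * w" by (simp add: w_def)
  ultimately show ?thesis unfolding idx_def w_def[symmetric] by (simp only:) linarith
qed

lemma mesh_LIMSEQ: "mesh \<longlonglongrightarrow> 0"
  by (rule LIMSEQ_realpow_zero) auto

lemma mesh_idx_LIMSEQ: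
  assumes "0 \<le> x"
  shows "(\<lambda>k. mesh k * real (idx k x)) \<longlonglongrightarrow> x"
proof (rule tendsto_sandwich)
  show "(\<lambda>k. x - mesh k) \<longlonglongrightarrow> x"
    using tendsto_diff[OF tendsto_const mesh_LIMSEQ] by simp
  show "\<forall>\<^sub>F k in sequentially. x - mesh k \<le> mesh k * real (idx k x)"
    using idx_bounds(2)[OF assms] by (intro always_eventually allI) (smt (verit))
  show "\<forall>\<^sub>F k in sequentially. mesh k * real (idx k x) \<le> x"
    using idx_bounds(1)[OF assms] by (intro always_eventually allI)
qed (rule tendsto_const)

text \<open>The increments from level \<open>k\<close> on sum to at most
  \<open>2 * c * mesh k\<close>; completeness supplies the limit.\<close>

lemma geometric_limit:
  fixes s :: "nat \<Rightarrow> 'a::banach"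
  assumes s: "\<And>k. m \<le> k \<Longrightarrow> norm (s (Suc k) - s k) \<le> c * mesh k"
  obtains l where "\<And>k. m \<le> k \<Longrightarrow> norm (s k - l) \<le> 2 * c * mesh k"
proof -
  have c: "0 \<le> c" using order_trans[OF norm_ge_zero s[of m]] by (auto intro: nonneg_if_mesh)
  \<comment> \<open>The exact partial sum of the geometric series is kept so that the induction
    closes; the subtracted term is dropped afterwards.\<close>
  have d: "norm (s (k + n) - s k) \<le> 2 * c * (mesh k - mesh (k + n))" if "m \<le> k" for k n
  proof (induction n)
    case (Suc n)
    have "norm (s (k + Suc n) - s k) \<le> norm (s (Suc (k + n)) - s (k + n)) + norm (s (k + n) - s k)"
      using norm_triangle_ineq[of "s (Suc (k + n)) - s (k + n)" "s (k + n) - s k"] by simp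
    also have "\<dots> \<le> c * mesh (k + n) + 2 * c * (mesh k - mesh (k + n))"
      using Suc s[of "k + n"] that by simp
    finally show ?case by (simp add: algebra_simps)
  qed simp
  have d': "norm (s n - s k) \<le> 2 * c * mesh k" if "m \<le> k" "k \<le> n" for k n
  proof -
    have "norm (s n - s k) \<le> 2 * c * (mesh k - mesh n)"
      using d[of k "n - k"] that by simp
    also have "\<dots> \<le> 2 * c * mesh k" using c by (intro mult_left_mono) auto
    finally show ?thesis .
  qed
  have "Cauchy s"
  proof (rule metric_CauchyI)
    fix e :: real assume "0 < e"
    have "(\<lambda>k. 2 * c * mesh k) \<longlonglongrightarrow> 2 * c * 0" by (intro tendsto_mult tendsto_const mesh_LIMSEQ)
    then have "\<forall>\<^sub>F k in sequentially. 2 * c * mesh k < e / 2"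
      using \<open>0 < e\<close> by (intro order_tendstoD) auto
    then obtain k0 where k0: "\<And>k. k0 \<le> k \<Longrightarrow> 2 * c * mesh k < e / 2"
      by (auto simp: eventually_sequentially)
    define k where "k = max m k0"
    have "dist (s n) (s k) < e / 2" if "k \<le> n" for n
      using d'[of k n] k0[of k] that by (simp add: k_def dist_norm)
    then show "\<exists>M. \<forall>p\<ge>M. \<forall>n\<ge>M. dist (s p) (s n) < e"
      by (meson dist_triangle_half_l)
  qed
  then obtain l where l: "s \<longlonglongrightarrow> l" by (auto simp: Cauchy_convergent_iff convergent_def)
  have "norm (s k - l) \<le> 2 * c * mesh k" if "m \<le> k" for k
  proof (rule Lim_norm_ubound[OF sequentially_bot])
    show "(\<lambda>n. s k - s n) \<longlonglongrightarrow> s k - l" by (intro tendsto_diff tendsto_const l)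
    show "\<forall>\<^sub>F n in sequentially. norm (s k - s n) \<le> 2 * c * mesh k"
      using d'[OF that] by (auto simp: eventually_sequentially norm_minus_commute)
  qed
  then show ?thesis by (rule that)
qed

lemma chain_bound:
  fixes p :: "nat \<Rightarrow> 'a::real_normed_vector"
  assumes "\<And>j. j < N \<Longrightarrow> norm (p (Suc j) - p j) \<le> c" "i + d \<le> N"
  shows "norm (p (i + d) - p i) \<le> c * d"
  using assms(2)
proof (induction d)
  case (Suc d)
  have "norm (p (i + Suc d) - p i) \<le> norm (p (Suc (i + d)) - p (i + d)) + norm (p (i + d) - p i)"
    using norm_triangle_ineq[of "p (Suc (i + d)) - p (i + d)" "p (i + d) - p i"] by simp
  also have "\<dots> \<le> c + c * d"
    using Suc assms(1)[of "i + d"] by simp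
  finally show ?case by (simp add: algebra_simps)
qed simp

lemma chain_bound':
  fixes p :: "nat \<Rightarrow> 'a::real_normed_vector"
  assumes "\<And>j. j < N \<Longrightarrow> norm (p (Suc j) - p j) \<le> c" "i \<le> N" "i' \<le> N"
  shows "norm (p i - p i') \<le> c * \<bar>real i - real i'\<bar>"
proof (cases "i' \<le> i")
  case True
  then show ?thesis using chain_bound[of N p c i' "i - i'"] assms by (simp add: of_nat_diff)
next
  case False
  then show ?thesis using chain_bound[of N p c i "i' - i"] assms
    by (simp add: of_nat_diff norm_minus_commute)
qed

section \<open>Grid functions and their limits on the square\<close>

definition grid_lipschitz :: "nat \<Rightarrow> real \<Rightarrow> (nat \<Rightarrow> nat \<Rightarrow> nat \<Rightarrow> 'a::real_normed_vector) \<Rightarrow> bool" where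
  "grid_lipschitz m L X \<longleftrightarrow> (\<forall>k\<ge>m.
    (\<forall>i<2^(k-m). \<forall>j\<le>2^(k-m). norm (X k (Suc i) j - X k i j) \<le> L * mesh k) \<and>
    (\<forall>i\<le>2^(k-m). \<forall>j<2^(k-m). norm (X k i (Suc j) - X k i j) \<le> L * mesh k))"

lemma grid_lipschitzD:
  assumes "grid_lipschitz m L X" "m \<le> k"
  shows "i < 2^(k-m) \<Longrightarrow> j \<le> 2^(k-m) \<Longrightarrow> norm (X k (Suc i) j - X k i j) \<le> L * mesh k"
    and "i \<le> 2^(k-m) \<Longrightarrow> j < 2^(k-m) \<Longrightarrow> norm (X k i (Suc j) - X k i j) \<le> L * mesh k"
  using assms by (auto simp: grid_lipschitz_def)

text \<open>Rounded-down indices make the limit a function on the whole square rather than on dyadic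
  points, and the rate belongs to the notion because the final claim is about order
  \<epsilon>.\<close>

definition grid_limit :: "nat \<Rightarrow> real \<Rightarrow> (nat \<Rightarrow> nat \<Rightarrow> nat \<Rightarrow> 'a::real_normed_vector) \<Rightarrow> (real \<Rightarrow> real \<Rightarrow> 'a) \<Rightarrow> bool" where
  "grid_limit m C X Y \<longleftrightarrow> (\<forall>k\<ge>m. \<forall>x\<in>{0..mesh m}. \<forall>y\<in>{0..mesh m}.
    norm (X k (idx k x) (idx k y) - Y x y) \<le> C * mesh k)"

text \<open>On refinement a rounded point moves by at most one fine step in each direction, costing
  twice \<open>L * mesh (Suc k) = L * mesh k / 2\<close>; at the common grid point the levels differ
  by \<open>G * mesh k\<close>. Summing over levels doubles \<open>G + L\<close>.\<close>

lemma ex_grid_limit: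
  fixes X :: "nat \<Rightarrow> nat \<Rightarrow> nat \<Rightarrow> 'a::banach"
  assumes lip: "grid_lipschitz m L X"
    and refine: "\<And>k i j. \<lbrakk>m \<le> k; i \<le> 2^(k-m); j \<le> 2^(k-m)\<rbrakk> \<Longrightarrow>
      norm (X (Suc k) (2 * i) (2 * j) - X k i j) \<le> G * mesh k"
  shows "\<exists>Y. grid_limit m (2 * (G + L)) X Y"
proof -
  have "\<exists>l. \<forall>k\<ge>m. norm (X k (idx k x) (idx k y) - l) \<le> 2 * (G + L) * mesh k"
    if xy: "x \<in> {0..mesh m}" "y \<in> {0..mesh m}" for x y
  proof (rule geometric_limit[of m "\<lambda>k. X k (idx k x) (idx k y)" "G + L"])
    fix k assume k: "m \<le> k"
    let ?X = "X (Suc k)" and ?i = "idx k x" and ?j = "idx k y"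
    let ?i' = "idx (Suc k) x" and ?j' = "idx (Suc k) y"
    have "norm (X k (Suc 0) 0 - X k 0 0) \<le> L * mesh k" using lip k by (simp add: grid_lipschitz_def)
    then have L: "0 \<le> L" by (intro nonneg_if_mesh[of L k]) (rule order_trans[OF norm_ge_zero])
    have b: "?i \<le> 2^(k-m)" "?j \<le> 2^(k-m)" "?i' \<le> 2^(Suc k-m)" "?j' \<le> 2^(Suc k-m)"
      using idx_le k xy by auto
    have b2: "2 * ?i \<le> 2^(Suc k-m)" "2 * ?j \<le> 2^(Suc k-m)"
      using b k by (simp_all add: Suc_diff_le)
    have mk: "m \<le> Suc k" using k by simp
    have i_cases: "?i' = 2 * ?i \<or> ?i' = Suc (2 * ?i)" and j_cases: "?j' = 2 * ?j \<or> ?j' = Suc (2 * ?j)"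
      using idx_Suc xy by auto
    have 1: "norm (?X ?i' ?j' - ?X (2 * ?i) ?j') \<le> L * mesh (Suc k)"
      using i_cases
    proof (elim disjE)
      assume i: "?i' = Suc (2 * ?i)"
      with b(3) have "2 * ?i < 2^(Suc k-m)" by simp
      then show ?thesis unfolding i by (rule grid_lipschitzD(1)[OF lip mk _ b(4)])
    qed (use L xy in auto)
    have 2: "norm (?X (2 * ?i) ?j' - ?X (2 * ?i) (2 * ?j)) \<le> L * mesh (Suc k)"
      using j_cases
    proof (elim disjE)
      assume j: "?j' = Suc (2 * ?j)"
      with b(4) have "2 * ?j < 2^(Suc k-m)" by simp
      then show ?thesis unfolding j by (rule grid_lipschitzD(2)[OF lip mk b2(1)])
    qed (use L xy in auto)
    have 3: "norm (?X (2 * ?i) (2 * ?j) - X k ?i ?j) \<le> G * mesh k"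
      by (rule refine[OF k b(1,2)])
    have "norm (?X ?i' ?j' - X k ?i ?j) \<le> L * mesh (Suc k) + (L * mesh (Suc k) + G * mesh k)"
      using norm_triangle_mono[OF 1 norm_triangle_mono[OF 2 3]] by simp
    then show "norm (?X ?i' ?j' - X k ?i ?j) \<le> (G + L) * mesh k"
      by (simp add: algebra_simps)
  qed auto
  then obtain Y where "\<And>x y. x \<in> {0..mesh m} \<Longrightarrow> y \<in> {0..mesh m} \<Longrightarrow>
      \<forall>k\<ge>m. norm (X k (idx k x) (idx k y) - Y x y) \<le> 2 * (G + L) * mesh k"
    by metis
  then show ?thesis unfolding grid_limit_def by (intro exI[of _ Y]) blast
qed

lemma grid_limit_LIMSEQ:
  assumes "grid_limit m C X Y" "x \<in> {0..mesh m}" "y \<in> {0..mesh m}"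
  shows "(\<lambda>k. X k (idx k x) (idx k y)) \<longlonglongrightarrow> Y x y"
proof (rule LIM_zero_cancel, rule Lim_null_comparison)
  show "\<forall>\<^sub>F k in sequentially. norm (X k (idx k x) (idx k y) - Y x y) \<le> C * mesh k"
    using assms unfolding grid_limit_def eventually_sequentially by blast
  show "(\<lambda>k. C * mesh k) \<longlonglongrightarrow> 0"
    using tendsto_mult[OF tendsto_const mesh_LIMSEQ, of C] by simp
qed

text \<open>A grid path that changes first x and then y gives the estimate at the rounded points,
  and rounding disappears in the limit.\<close>

lemma grid_limit_lipschitz:
  fixes X :: "nat \<Rightarrow> nat \<Rightarrow> nat \<Rightarrow> 'a::real_normed_vector"
  assumes lip: "grid_lipschitz m L X" and lim: "grid_limit m C X Y"
    and p: "x \<in> {0..mesh m}" "y \<in> {0..mesh m}" "x' \<in> {0..mesh m}" "y' \<in> {0..mesh m}"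
  shows "norm (Y x y - Y x' y') \<le> L * (\<bar>x - x'\<bar> + \<bar>y - y'\<bar>)"
proof (rule LIMSEQ_le)
  show "(\<lambda>k. norm (X k (idx k x) (idx k y) - X k (idx k x') (idx k y'))) \<longlonglongrightarrow> norm (Y x y - Y x' y')"
    by (intro tendsto_norm tendsto_diff grid_limit_LIMSEQ[OF lim] p)
  show "(\<lambda>k. L * (\<bar>mesh k * idx k x - mesh k * idx k x'\<bar> + \<bar>mesh k * idx k y - mesh k * idx k y'\<bar>))
      \<longlonglongrightarrow> L * (\<bar>x - x'\<bar> + \<bar>y - y'\<bar>)"
    using p by (intro tendsto_intros mesh_idx_LIMSEQ) auto
  have "norm (X k (idx k x) (idx k y) - X k (idx k x') (idx k y')) \<le>
      L * (\<bar>mesh k * idx k x - mesh k * idx k x'\<bar> + \<bar>mesh k * idx k y - mesh k * idx k y'\<bar>)"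
    if k: "m \<le> k" for k
  proof -
    note b = idx_le[OF k]
    have 1: "norm (X k (idx k x) (idx k y) - X k (idx k x') (idx k y)) \<le> (L * mesh k) * \<bar>real (idx k x) - real (idx k x')\<bar>"
      using lip k p b by (intro chain_bound'[of "2^(k-m)" "\<lambda>i. X k i (idx k y)"]) (auto simp: grid_lipschitz_def)
    have 2: "norm (X k (idx k x') (idx k y) - X k (idx k x') (idx k y')) \<le> (L * mesh k) * \<bar>real (idx k y) - real (idx k y')\<bar>"
      using lip k p b by (intro chain_bound'[of "2^(k-m)" "X k (idx k x')"]) (auto simp: grid_lipschitz_def)
    have "\<bar>mesh k * a - mesh k * b\<bar> = mesh k * \<bar>a - b\<bar>" for a b :: real
      by (simp add: abs_mult flip: right_diff_distrib)
    then show ?thesis using norm_triangle_mono[OF 1 2] by (simp add: algebra_simps)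
  qed
  then show "\<exists>N. \<forall>k\<ge>N. norm (X k (idx k x) (idx k y) - X k (idx k x') (idx k y')) \<le>
      L * (\<bar>mesh k * idx k x - mesh k * idx k x'\<bar> + \<bar>mesh k * idx k y - mesh k * idx k y'\<bar>)"
    by blast
qed

section \<open>From difference equations to derivatives\<close>

lemma quadratic_remainder_derivative:
  fixes P :: "real \<Rightarrow> 'a::real_normed_vector"
  assumes "\<And>t. t \<in> S \<Longrightarrow> norm (P t - P y - (t - y) *\<^sub>R Q) \<le> C * (t - y)\<^sup>2"
  shows "(P has_vector_derivative Q) (at y within S)"
  unfolding has_vector_derivative_def has_derivative_within_alt
proof (intro conjI allI impI bounded_linear_scaleR_left)
  fix e :: real assume e: "0 < e"
  show "\<exists>d>0. \<forall>t\<in>S. norm (t - y) < d \<longrightarrow> norm (P t - P y - (t - y) *\<^sub>R Q) \<le> e * norm (t - y)"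
  proof (intro exI[of _ "e / (\<bar>C\<bar> + 1)"] conjI ballI impI)
    fix t assume t: "t \<in> S" "norm (t - y) < e / (\<bar>C\<bar> + 1)"
    have "norm (P t - P y - (t - y) *\<^sub>R Q) \<le> C * (t - y)\<^sup>2" by (rule assms[OF t(1)])
    also have "\<dots> \<le> (\<bar>C\<bar> + 1) * (t - y)\<^sup>2" by (intro mult_right_mono) auto
    also have "\<dots> = ((\<bar>C\<bar> + 1) * norm (t - y)) * norm (t - y)"
      by (simp add: power2_eq_square abs_mult_self_eq mult.assoc)
    also have "\<dots> \<le> e * norm (t - y)"
      using t(2) by (intro mult_right_mono) (auto simp: field_simps)
    finally show "norm (P t - P y - (t - y) *\<^sub>R Q) \<le> e * norm (t - y)" .
  qed (use e in auto)
qed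

text \<open>Euler steps are summed over a fixed distance while the mesh tends to 0. The accumulated
  defects vanish and the drift of \<open>G\<close> leaves a remainder quadratic in the distance,
  which characterises the derivative, one-sided at the end points.\<close>

lemma grid_derivative:
  fixes p G :: "nat \<Rightarrow> nat \<Rightarrow> 'a::real_normed_vector" and P Q :: "real \<Rightarrow> 'a"
  assumes P: "\<And>y. y \<in> {0..mesh m} \<Longrightarrow> (\<lambda>k. p k (idx k y)) \<longlonglongrightarrow> P y"
    and Q: "\<And>y. y \<in> {0..mesh m} \<Longrightarrow> (\<lambda>k. G k (idx k y)) \<longlonglongrightarrow> Q y"
    and step: "\<And>k j. m \<le> k \<Longrightarrow> j < 2^(k-m) \<Longrightarrow> norm (p k (Suc j) - p k j - mesh k *\<^sub>R G k j) \<le> C * (mesh k)\<^sup>2"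
    and var: "\<And>k j. m \<le> k \<Longrightarrow> j < 2^(k-m) \<Longrightarrow> norm (G k (Suc j) - G k j) \<le> C * mesh k"
    and y: "y \<in> {0..mesh m}"
  shows "(P has_vector_derivative Q y) (at y within {0..mesh m})"
proof -
  have G: "norm (G k (j + d) - G k j) \<le> C * mesh k * d" if "m \<le> k" "j + d \<le> 2^(k-m)" for k j d
    using var that by (intro chain_bound[of "2^(k-m)"]) auto
  \<comment> \<open>The first term collects \<open>d\<close> one-step defects of size
    \<open>C * (mesh k)^2\<close> and tends to 0 for a fixed distance \<open>mesh k * d\<close>; the
    second collects the drift of \<open>G\<close> away from its initial value.\<close>
  have rem: "norm (p k (j + d) - p k j - (mesh k * d) *\<^sub>R G k j) \<le> C * mesh k * (mesh k * d) + C * (mesh k * d)\<^sup>2"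
    if "m \<le> k" "j + d \<le> 2^(k-m)" for k j d
    using that(2)
  proof (induction d)
    case (Suc d)
    let ?h = "mesh k"
    have C: "0 \<le> C"
      using order_trans[OF norm_ge_zero var[of k j]] Suc.prems that(1) by (auto intro: nonneg_if_mesh)
    have 1: "norm (p k (j + d) - p k j - (?h * d) *\<^sub>R G k j) \<le> C * ?h * (?h * d) + C * (?h * d)\<^sup>2"
      using Suc by simp
    have 2: "norm (p k (Suc (j + d)) - p k (j + d) - ?h *\<^sub>R G k (j + d)) \<le> C * ?h\<^sup>2"
      using step[of k "j + d"] Suc.prems that(1) by simp
    have 3: "norm (?h *\<^sub>R (G k (j + d) - G k j)) \<le> ?h * (C * ?h * d)"
      using G[of k j d] Suc.prems that(1) by (simp add: mult_left_mono)
    have "p k (j + Suc d) - p k j - (?h * Suc d) *\<^sub>R G k j =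
      (p k (j + d) - p k j - (?h * d) *\<^sub>R G k j) + ((p k (Suc (j + d)) - p k (j + d) - ?h *\<^sub>R G k (j + d)) +
        ?h *\<^sub>R (G k (j + d) - G k j))"
      by (simp add: algebra_simps)
    then have "norm (p k (j + Suc d) - p k j - (?h * Suc d) *\<^sub>R G k j) \<le>
      C * ?h * (?h * d) + C * (?h * d)\<^sup>2 + (C * ?h\<^sup>2 + ?h * (C * ?h * d))"
      using norm_triangle_mono[OF 1 norm_triangle_mono[OF 2 3]] by (simp only:)
    also have "\<dots> \<le> \<dots> + C * ?h\<^sup>2 * (real d + 1)" using C by simp
    also have "\<dots> = C * ?h * (?h * Suc d) + C * (?h * Suc d)\<^sup>2"
      by (simp add: algebra_simps power2_eq_square)
    finally show ?case .
  qed simp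
  define dd where "dd s t k = mesh k * real (idx k t - idx k s)" for s t k
  have dd: "dd s t \<longlonglongrightarrow> t - s" if "s \<in> {0..mesh m}" "t \<in> {0..mesh m}" "s \<le> t" for s t
  proof -
    have "(\<lambda>k. mesh k * idx k t - mesh k * idx k s) \<longlonglongrightarrow> t - s"
      using that by (intro tendsto_diff mesh_idx_LIMSEQ) auto
    moreover have "dd s t = (\<lambda>k. mesh k * idx k t - mesh k * idx k s)"
      unfolding dd_def using idx_mono[OF that(3)] by (simp add: of_nat_diff right_diff_distrib)
    ultimately show ?thesis by simp
  qed
  have fw: "norm (P t - P s - (t - s) *\<^sub>R Q s) \<le> C * (t - s)\<^sup>2" and var': "norm (Q t - Q s) \<le> C * (t - s)"
    if s: "s \<in> {0..mesh m}" and t: "t \<in> {0..mesh m}" and st: "s \<le> t" for s t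
  proof -
    have ex: "idx k s + (idx k t - idx k s) = idx k t" for k using idx_mono[OF st, of k] by simp
    then have ex_le: "idx k s + (idx k t - idx k s) \<le> 2^(k-m)" if "m \<le> k" for k
      using idx_le[OF that] t by simp
    show "norm (P t - P s - (t - s) *\<^sub>R Q s) \<le> C * (t - s)\<^sup>2"
    proof (rule LIMSEQ_le)
      show "(\<lambda>k. norm (p k (idx k t) - p k (idx k s) - dd s t k *\<^sub>R G k (idx k s))) \<longlonglongrightarrow>
          norm (P t - P s - (t - s) *\<^sub>R Q s)"
        by (intro tendsto_intros P Q dd s t st)
      have "(\<lambda>k. C * mesh k * dd s t k + C * (dd s t k)\<^sup>2) \<longlonglongrightarrow> C * 0 * (t - s) + C * (t - s)\<^sup>2"
        by (intro tendsto_intros dd s t st mesh_LIMSEQ)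
      then show "(\<lambda>k. C * mesh k * dd s t k + C * (dd s t k)\<^sup>2) \<longlonglongrightarrow> C * (t - s)\<^sup>2" by simp
      show "\<exists>N. \<forall>k\<ge>N. norm (p k (idx k t) - p k (idx k s) - dd s t k *\<^sub>R G k (idx k s)) \<le>
          C * mesh k * dd s t k + C * (dd s t k)\<^sup>2"
        using rem[OF _ ex_le, unfolded ex] unfolding dd_def by blast
    qed
    show "norm (Q t - Q s) \<le> C * (t - s)"
    proof (rule LIMSEQ_le)
      show "(\<lambda>k. norm (G k (idx k t) - G k (idx k s))) \<longlonglongrightarrow> norm (Q t - Q s)"
        by (intro tendsto_intros Q s t)
      show "(\<lambda>k. C * dd s t k) \<longlonglongrightarrow> C * (t - s)"
        by (intro tendsto_intros dd s t st)
      show "\<exists>N. \<forall>k\<ge>N. norm (G k (idx k t) - G k (idx k s)) \<le> C * dd s t k"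
        using G[OF _ ex_le, unfolded ex mult.assoc] unfolding dd_def by blast
    qed
  qed
  have "norm (P t - P y - (t - y) *\<^sub>R Q y) \<le> (2 * \<bar>C\<bar>) * (t - y)\<^sup>2" if t: "t \<in> {0..mesh m}" for t
  proof (cases "y \<le> t")
    case True
    have "C * (t - y)\<^sup>2 \<le> (2 * \<bar>C\<bar>) * (t - y)\<^sup>2" by (intro mult_right_mono) auto
    then show ?thesis using fw[OF y t True] by linarith
  next
    case False
    then have ty: "t \<le> y" by simp
    \<comment> \<open>To the left of \<open>y\<close> only the expansion about \<open>t\<close> is
      available; replacing \<open>Q t\<close> by \<open>Q y\<close> costs another
      \<open>C * (y - t)^2\<close>, whence the factor 2.\<close>
    have 1: "norm (P y - P t - (y - t) *\<^sub>R Q t) \<le> C * (y - t)\<^sup>2" by (rule fw[OF t y ty])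
    have 2: "norm ((y - t) *\<^sub>R (Q y - Q t)) \<le> (y - t) * (C * (y - t))"
      using var'[OF t y ty] ty by (simp add: mult_left_mono)
    have "P t - P y - (t - y) *\<^sub>R Q y = (y - t) *\<^sub>R (Q y - Q t) - (P y - P t - (y - t) *\<^sub>R Q t)"
      by (simp add: algebra_simps)
    then have "norm (P t - P y - (t - y) *\<^sub>R Q y) \<le> (y - t) * (C * (y - t)) + C * (y - t)\<^sup>2"
      using order_trans[OF norm_triangle_ineq4 add_mono[OF 2 1]] by (simp only:)
    also have "\<dots> = (2 * C) * (t - y)\<^sup>2" by (simp add: algebra_simps power2_eq_square)
    also have "\<dots> \<le> (2 * \<bar>C\<bar>) * (t - y)\<^sup>2" by (intro mult_right_mono) auto
    finally show ?thesis .
  qed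
  then show ?thesis by (rule quadratic_remainder_derivative)
qed

section \<open>Lipschitz and refinement bounds\<close>

context layered_system
begin

section \<open>Shifted and coarsened approximate solutions\<close>

lemma insideD:
  assumes "all_inside N M A B T" "i \<le> N" "j \<le> M" "z \<le> R"
  shows "inside A B T i j z" "A i j z \<in> SA z" "B i j z \<in> SB z" "T i j z \<in> ST z"
  using assms by (auto simp: all_inside_def inside_def)

lemma close_atD:
  assumes "close_at c A B T A' B' T' i j z"
  shows "norm (A i j z - A' i j z) \<le> c" "norm (B i j z - B' i j z) \<le> c" "norm (T i j z - T' i j z) \<le> c"
  using assms by (auto simp: close_at_def)

lemma defect_restrict: "defect e D N M A B T \<Longrightarrow> N' \<le> N \<Longrightarrow> M' \<le> M \<Longrightarrow> defect e D N' M' A B T"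
  by (auto simp: defect_def)

lemma all_inside_restrict: "all_inside N M A B T \<Longrightarrow> N' \<le> N \<Longrightarrow> M' \<le> M \<Longrightarrow> all_inside N' M' A B T"
  unfolding all_inside_def[of N' M'] by (intro allI impI insideD(1)[of N M]) auto

text \<open>The right-hand sides do not depend on the position, so a translate satisfies the same
  equations on a grid with one row fewer.\<close>

lemma defect_shift_y:
  "defect e D N (Suc M) A B T \<Longrightarrow>
    defect e D N M (\<lambda>i j. A i (Suc j)) (\<lambda>i j. B i (Suc j)) (\<lambda>i j. T i (Suc j))"
  by (auto simp: defect_def inside_def)

lemma defect_shift_x:
  "defect e D (Suc N) M A B T \<Longrightarrow>
    defect e D N M (\<lambda>i. A (Suc i)) (\<lambda>i. B (Suc i)) (\<lambda>i. T (Suc i))"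
  by (auto simp: defect_def inside_def)

text \<open>Two fine steps form one coarse step except that the second evaluates \<open>F\<close> at
  a moved point. This costs \<open>e * 2 * K * w\<close>, which is \<open>K * w\<close> relative to
  the step length \<open>2 * e\<close>.\<close>

lemma double_step:
  fixes x0 x1 x2 :: 'a
  assumes F: "controlled K S S' F" "p0 \<in> S" "p1 \<in> S" "q0 \<in> S'" "q1 \<in> S'"
    and "norm (x1 - x0 - e *\<^sub>R F p0 q0) \<le> e * D" "norm (x2 - x1 - e *\<^sub>R F p1 q1) \<le> e * D"
    and "norm (p1 - p0) \<le> w" "norm (q1 - q0) \<le> w" and e: "0 \<le> e"
  shows "norm (x2 - x0 - (2 * e) *\<^sub>R F p0 q0) \<le> 2 * e * (D + K * w)"
proof -
  have "norm (F p1 q1 - F p0 q0) \<le> 2 * K * w"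
    using assms K by (intro controlled_lipschitz_le[OF F(1)]) auto
  then have 1: "norm (e *\<^sub>R (F p1 q1 - F p0 q0)) \<le> e * (2 * K * w)"
    using e by (simp add: mult_left_mono)
  have "x2 - x0 - (2 * e) *\<^sub>R F p0 q0 =
      (x1 - x0 - e *\<^sub>R F p0 q0) + ((x2 - x1 - e *\<^sub>R F p1 q1) + e *\<^sub>R (F p1 q1 - F p0 q0))"
    by (simp add: scaleR_diff_right mult.commute[of 2 e] flip: scaleR_scaleR) (simp add: scaleR_2 scaleR_add_right)
  then have "norm (x2 - x0 - (2 * e) *\<^sub>R F p0 q0) \<le> e * D + (e * D + e * (2 * K * w))"
    using norm_triangle_mono[OF assms(6) norm_triangle_mono[OF assms(7) 1]] by (simp only:)
  then show ?thesis by (simp add: algebra_simps)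
qed

text \<open>Here \<open>w\<close> bounds the change over one fine step. Under the Lipschitz bounds
  it is of the order of the mesh, so coarsening preserves the order of the defect.\<close>

lemma defect_coarsen:
  assumes def: "defect e D (2 * N) (2 * M) A B T" and ins: "all_inside (2 * N) (2 * M) A B T"
    and x: "\<And>i j z. i < 2 * N \<Longrightarrow> j \<le> 2 * M \<Longrightarrow> z \<le> R \<Longrightarrow>
      close_at w (\<lambda>i. A (Suc i)) (\<lambda>i. B (Suc i)) (\<lambda>i. T (Suc i)) A B T i j z"
    and y: "\<And>i j z. i \<le> 2 * N \<Longrightarrow> j < 2 * M \<Longrightarrow> z \<le> R \<Longrightarrow>
      close_at w (\<lambda>i j. A i (Suc j)) (\<lambda>i j. B i (Suc j)) (\<lambda>i j. T i (Suc j)) A B T i j z"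
    and e: "0 \<le> e" and w: "0 \<le> w"
  shows "defect (2 * e) (D + K * w) N M
    (\<lambda>i j. A (2 * i) (2 * j)) (\<lambda>i j. B (2 * i) (2 * j)) (\<lambda>i j. T (2 * i) (2 * j))"
  unfolding defect_def
proof (intro allI impI)
  fix i j z assume ijz: "i \<le> N" "j \<le> M" "z \<le> R"
  then have i2: "2 * i \<le> 2 * N" and j2: "2 * j \<le> 2 * M" by auto
  note I0 = insideD[OF ins i2 j2 ijz(3)]
  have "j < M \<longrightarrow>
      norm (A (2 * i) (2 * Suc j) z - A (2 * i) (2 * j) z - (2 * e) *\<^sub>R f (A (2 * i) (2 * j) z) (B (2 * i) (2 * j) z))
        \<le> 2 * e * (D + K * w) \<and>
      norm (T (2 * i) (2 * Suc j) z - T (2 * i) (2 * j) z - (2 * e) *\<^sub>R v (B (2 * i) (2 * j) z) (T (2 * i) (2 * j) z))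
        \<le> 2 * e * (D + K * w)"
  proof
    assume j: "j < M"
    then have j1: "2 * j < 2 * M" "Suc (2 * j) < 2 * M" "Suc (2 * j) \<le> 2 * M" by auto
    have s: "2 * Suc j = Suc (Suc (2 * j))" by simp
    note I1 = insideD[OF ins i2 j1(3) ijz(3)]
    note d0 = defectD[OF def I0(1) i2 j2 ijz(3)] and d1 = defectD[OF def I1(1) i2 j1(3) ijz(3)]
    note c = close_atD[OF y[OF i2 j1(1) ijz(3)]]
    show "norm (A (2 * i) (2 * Suc j) z - A (2 * i) (2 * j) z - (2 * e) *\<^sub>R f (A (2 * i) (2 * j) z) (B (2 * i) (2 * j) z))
        \<le> 2 * e * (D + K * w) \<and>
      norm (T (2 * i) (2 * Suc j) z - T (2 * i) (2 * j) z - (2 * e) *\<^sub>R v (B (2 * i) (2 * j) z) (T (2 * i) (2 * j) z))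
        \<le> 2 * e * (D + K * w)"
      unfolding s
      using double_step[OF controlled(1)[OF ijz(3)] I0(2) I1(2) I0(3) I1(3) d0(1)[OF j1(1)] d1(1)[OF j1(2)] c(1,2) e]
        double_step[OF controlled(4)[OF ijz(3)] I0(3) I1(3) I0(4) I1(4) d0(2)[OF j1(1)] d1(2)[OF j1(2)] c(2,3) e]
      by blast
  qed
  moreover have "i < N \<longrightarrow>
      norm (B (2 * Suc i) (2 * j) z - B (2 * i) (2 * j) z - (2 * e) *\<^sub>R g (A (2 * i) (2 * j) z) (B (2 * i) (2 * j) z))
        \<le> 2 * e * (D + K * w) \<and>
      norm (T (2 * Suc i) (2 * j) z - T (2 * i) (2 * j) z - (2 * e) *\<^sub>R u (A (2 * i) (2 * j) z) (T (2 * i) (2 * j) z))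
        \<le> 2 * e * (D + K * w)"
  proof
    assume i: "i < N"
    then have i1: "2 * i < 2 * N" "Suc (2 * i) < 2 * N" "Suc (2 * i) \<le> 2 * N" by auto
    have s: "2 * Suc i = Suc (Suc (2 * i))" by simp
    note I1 = insideD[OF ins i1(3) j2 ijz(3)]
    note d0 = defectD[OF def I0(1) i2 j2 ijz(3)] and d1 = defectD[OF def I1(1) i1(3) j2 ijz(3)]
    note c = close_atD[OF x[OF i1(1) j2 ijz(3)]]
    show "norm (B (2 * Suc i) (2 * j) z - B (2 * i) (2 * j) z - (2 * e) *\<^sub>R g (A (2 * i) (2 * j) z) (B (2 * i) (2 * j) z))
        \<le> 2 * e * (D + K * w) \<and>
      norm (T (2 * Suc i) (2 * j) z - T (2 * i) (2 * j) z - (2 * e) *\<^sub>R u (A (2 * i) (2 * j) z) (T (2 * i) (2 * j) z))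
        \<le> 2 * e * (D + K * w)"
      unfolding s
      using double_step[OF controlled(2)[OF ijz(3)] I0(2) I1(2) I0(3) I1(3) d0(3)[OF i1(1)] d1(3)[OF i1(2)] c(1,2) e]
        double_step[OF controlled(3)[OF ijz(3)] I0(2) I1(2) I0(4) I1(4) d0(4)[OF i1(1)] d1(4)[OF i1(2)] c(1,3) e]
      by blast
  qed
  \<comment> \<open>The z-direction is not coarsened, so its old error only has to be dominated by
    the new one.\<close>
  moreover have "D \<le> D + K * w" using K w by simp
  then have "z < R \<longrightarrow>
      norm (A (2 * i) (2 * j) (Suc z) - A (2 * i) (2 * j) z - \<xi> (A (2 * i) (2 * j) z) (T (2 * i) (2 * j) z)) \<le> D + K * w \<and>
      norm (B (2 * i) (2 * j) (Suc z) - B (2 * i) (2 * j) z - \<eta> (B (2 * i) (2 * j) z) (T (2 * i) (2 * j) z)) \<le> D + K * w"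
    using defectD(5,6)[OF def I0(1) i2 j2 ijz(3)] by (auto intro: order_trans)
  ultimately show "(j < M \<longrightarrow>
      norm (A (2 * i) (2 * Suc j) z - A (2 * i) (2 * j) z - (2 * e) *\<^sub>R f (A (2 * i) (2 * j) z) (B (2 * i) (2 * j) z))
        \<le> 2 * e * (D + K * w) \<and>
      norm (T (2 * i) (2 * Suc j) z - T (2 * i) (2 * j) z - (2 * e) *\<^sub>R v (B (2 * i) (2 * j) z) (T (2 * i) (2 * j) z))
        \<le> 2 * e * (D + K * w)) \<and>
    (i < N \<longrightarrow>
      norm (B (2 * Suc i) (2 * j) z - B (2 * i) (2 * j) z - (2 * e) *\<^sub>R g (A (2 * i) (2 * j) z) (B (2 * i) (2 * j) z))
        \<le> 2 * e * (D + K * w) \<and>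
      norm (T (2 * Suc i) (2 * j) z - T (2 * i) (2 * j) z - (2 * e) *\<^sub>R u (A (2 * i) (2 * j) z) (T (2 * i) (2 * j) z))
        \<le> 2 * e * (D + K * w)) \<and>
    (z < R \<longrightarrow>
      norm (A (2 * i) (2 * j) (Suc z) - A (2 * i) (2 * j) z - \<xi> (A (2 * i) (2 * j) z) (T (2 * i) (2 * j) z)) \<le> D + K * w \<and>
      norm (B (2 * i) (2 * j) (Suc z) - B (2 * i) (2 * j) z - \<eta> (B (2 * i) (2 * j) z) (T (2 * i) (2 * j) z)) \<le> D + K * w)"
    by blast
qed

end

text \<open>Interface between localisation and limit: on the square of side \<open>mesh m\<close>
  all levels \<open>k \<ge> m\<close> already stay in the sets. Closedness keeps the limits in the
  region where the right-hand sides are controlled.\<close>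

locale approximating_family = layered_system f g u v \<xi> \<eta> SA SB ST R K
  for f g u v \<xi> \<eta> :: "'a::banach \<Rightarrow> 'a \<Rightarrow> 'a" and SA SB ST R K +
  fixes A B T :: "nat \<Rightarrow> nat \<Rightarrow> nat \<Rightarrow> nat \<Rightarrow> 'a" and m :: nat and C :: real
    and a0 b0 :: "real \<Rightarrow> 'a" and \<theta>0 :: "nat \<Rightarrow> 'a"
  assumes C: "0 \<le> C"
    and closed: "z \<le> R \<Longrightarrow> closed (SA z)" "z \<le> R \<Longrightarrow> closed (SB z)" "z \<le> R \<Longrightarrow> closed (ST z)"
    and defect: "m \<le> k \<Longrightarrow> defect (mesh k) (C * mesh k) (2^(k-m)) (2^(k-m)) (A k) (B k) (T k)"
    and all_inside: "m \<le> k \<Longrightarrow> all_inside (2^(k-m)) (2^(k-m)) (A k) (B k) (T k)"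
    and data: "m \<le> k \<Longrightarrow> i \<le> 2^(k-m) \<Longrightarrow> norm (A k i 0 0 - a0 (mesh k * i)) \<le> C * mesh k"
      "m \<le> k \<Longrightarrow> i \<le> 2^(k-m) \<Longrightarrow> norm (B k 0 i 0 - b0 (mesh k * i)) \<le> C * mesh k"
      "m \<le> k \<Longrightarrow> z \<le> R \<Longrightarrow> norm (T k 0 0 z - \<theta>0 z) \<le> C * mesh k"
    and lipschitz_data: "C-lipschitz_on {0..mesh m} a0" "C-lipschitz_on {0..mesh m} b0"
begin

text \<open>\<open>3 * C\<close> is the Lipschitz change over one step plus the approximation error
  at both ends.\<close>

lemma data_step:
  assumes p: "C-lipschitz_on {0..mesh m} p" and k: "m \<le> k" and i: "i < 2^(k-m)"
    and P: "\<And>i. i \<le> 2^(k-m) \<Longrightarrow> norm (P i - p (mesh k * real i)) \<le> C * mesh k"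
  shows "norm (P (Suc i) - P i) \<le> 3 * C * mesh k"
proof -
  have "mesh k * real (Suc i) \<le> mesh k * real (2^(k-m))"
    using i by (intro mult_left_mono of_nat_mono) auto
  then have S: "mesh k * real (Suc i) \<le> mesh m" using mesh_mult_power[OF k] by simp
  then have i': "mesh k * real i \<le> mesh m" by (simp add: algebra_simps) (smt (verit) mesh_pos)
  have 1: "norm (p (mesh k * real (Suc i)) - p (mesh k * real i)) \<le> C * mesh k"
    using lipschitz_onD[OF p, of "mesh k * real (Suc i)" "mesh k * real i"] S i'
    by (simp add: dist_norm algebra_simps)
  have 2: "norm (P (Suc i) - p (mesh k * real (Suc i))) \<le> C * mesh k" using i by (intro P) simp
  have 3: "norm (p (mesh k * real i) - P i) \<le> C * mesh k" using P[of i] i by (simp add: norm_minus_commute)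
  show ?thesis using norm_triangle_mono[OF 2 norm_triangle_mono[OF 1 3]] by simp
qed

lemma mesh_le_1: "m \<le> k \<Longrightarrow> mesh k * real (2^(k-m)) \<le> 1"
  using mesh_mult_power[of m k] by (simp add: power_le_one)

text \<open>Comparing a solution with its shift also needs the first step away from an axis, where
  no data are prescribed; there the equation itself bounds the increment. The \<open>3 * C\<close>
  matches the constant of \<open>data_step\<close>.\<close>

lemma first_step:
  assumes "norm (x1 - x - mesh k *\<^sub>R F p q) \<le> mesh k * (C * mesh k)" "norm (F p q) \<le> K"
  shows "norm (x1 - x) \<le> (K + 3 * C) * mesh k"
proof -
  have "norm (x1 - x) \<le> mesh k * (K + C * mesh k)" using assms by (intro step_bound) auto
  also have "\<dots> \<le> mesh k * (K + 3 * C)"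
    using C mult_left_mono[OF power_le_one[of "1/2::real" k] C] by (intro mult_left_mono add_left_mono) auto
  finally show ?thesis by (simp add: mult.commute)
qed

lemma ex_grid_lipschitz:
  "\<exists>L\<ge>0. \<forall>z\<le>R. grid_lipschitz m L (\<lambda>k i j. A k i j z) \<and> grid_lipschitz m L (\<lambda>k i j. B k i j z) \<and>
    grid_lipschitz m L (\<lambda>k i j. T k i j z)"
proof -
  obtain G where G: "comparison_factor R G" using ex_comparison_factor by blast
  then have G0: "0 \<le> G" by (simp add: comparison_factor_def)
  \<comment> \<open>This \<open>D\<close> dominates three things at once: the increments of the data
    along the axes, the first steps off the axes, and the defect constant \<open>C\<close>.\<close>
  define D where "D = K + 3 * C"
  have D: "0 \<le> D" using K C by (simp add: D_def)
  have close: "i < 2^(k-m) \<Longrightarrow> j \<le> 2^(k-m) \<Longrightarrow>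
      close_at (G * (D * mesh k)) (\<lambda>i. A k (Suc i)) (\<lambda>i. B k (Suc i)) (\<lambda>i. T k (Suc i)) (A k) (B k) (T k) i j z"
    "i \<le> 2^(k-m) \<Longrightarrow> j < 2^(k-m) \<Longrightarrow>
      close_at (G * (D * mesh k)) (\<lambda>i j. A k i (Suc j)) (\<lambda>i j. B k i (Suc j)) (\<lambda>i j. T k i (Suc j)) (A k) (B k) (T k) i j z"
    if k: "m \<le> k" and z: "z \<le> R" for k i j z
  proof -
    \<comment> \<open>The shifted solution lives on a grid one row shorter, so the side is written
      as a successor.\<close>
    obtain M where M: "2^(k-m) = Suc M" by (metis not0_implies_Suc power_not_zero zero_neq_numeral)
    have def: "defect (mesh k) (D * mesh k) (Suc M) (Suc M) (A k) (B k) (T k)"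
      using defect[OF k] unfolding M by (rule defect_mono) (use K C in \<open>auto simp: D_def intro!: mult_right_mono\<close>)
    have ins: "all_inside (Suc M) (Suc M) (A k) (B k) (T k)" using all_inside[OF k] by (simp add: M)
    have le1: "mesh k * real (Suc M) \<le> 1" using mesh_le_1[OF k] unfolding M .
    then have le1': "mesh k * real M \<le> 1" by (simp add: algebra_simps) (smt (verit) mesh_pos)
    have D_mesh: "0 \<le> D * mesh k" using D by simp
    have CD: "3 * C * mesh k \<le> D * mesh k" using K by (simp add: D_def)
    have m0: "0 \<le> mesh k" by simp
    note I = insideD[OF ins] and d = defectD[OF defect[OF k, unfolded M]]
    show "close_at (G * (D * mesh k)) (\<lambda>i. A k (Suc i)) (\<lambda>i. B k (Suc i)) (\<lambda>i. T k (Suc i)) (A k) (B k) (T k) i j z"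
      if ij: "i < 2^(k-m)" "j \<le> 2^(k-m)"
    proof (rule comparison_factorD[OF G defect_shift_x[OF def] defect_restrict[OF def]
          _ all_inside_restrict[OF ins] m0 le1' le1 D_mesh])
      show "all_inside M (Suc M) (\<lambda>i. A k (Suc i)) (\<lambda>i. B k (Suc i)) (\<lambda>i. T k (Suc i))"
        using ins by (auto simp: all_inside_def inside_def)
      show "norm (A k (Suc i) 0 0 - A k i 0 0) \<le> D * mesh k" if "i \<le> M" for i
        using that by (intro order_trans[OF data_step[OF lipschitz_data(1) k _ data(1)[OF k]] CD]) (auto simp: M)
      show "norm (B k (Suc 0) j 0 - B k 0 j 0) \<le> D * mesh k" if j: "j \<le> Suc M" for j
        unfolding D_def
        by (rule first_step[where F = g, OF d(3)[OF I(1)] controlled_bound[OF controlled(2)]])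
          (use j I in auto)
      show "norm (T k (Suc 0) 0 z - T k 0 0 z) \<le> D * mesh k" if "z \<le> R" for z
        unfolding D_def
        by (rule first_step[where F = u, OF d(4)[OF I(1)] controlled_bound[OF controlled(3)]])
          (use that I in auto)
    qed (use ij z M in auto)
    show "close_at (G * (D * mesh k)) (\<lambda>i j. A k i (Suc j)) (\<lambda>i j. B k i (Suc j)) (\<lambda>i j. T k i (Suc j)) (A k) (B k) (T k) i j z"
      if ij: "i \<le> 2^(k-m)" "j < 2^(k-m)"
    proof (rule comparison_factorD[OF G defect_shift_y[OF def] defect_restrict[OF def]
          _ all_inside_restrict[OF ins] m0 le1 le1' D_mesh])
      show "all_inside (Suc M) M (\<lambda>i j. A k i (Suc j)) (\<lambda>i j. B k i (Suc j)) (\<lambda>i j. T k i (Suc j))"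
        using ins by (auto simp: all_inside_def inside_def)
      show "norm (B k 0 (Suc j) 0 - B k 0 j 0) \<le> D * mesh k" if "j \<le> M" for j
        using that by (intro order_trans[OF data_step[OF lipschitz_data(2) k _ data(2)[OF k]] CD]) (auto simp: M)
      show "norm (A k i (Suc 0) 0 - A k i 0 0) \<le> D * mesh k" if i: "i \<le> Suc M" for i
        unfolding D_def
        by (rule first_step[where F = f, OF d(1)[OF I(1)] controlled_bound[OF controlled(1)]])
          (use i I in auto)
      show "norm (T k 0 (Suc 0) z - T k 0 0 z) \<le> D * mesh k" if "z \<le> R" for z
        unfolding D_def
        by (rule first_step[where F = v, OF d(2)[OF I(1)] controlled_bound[OF controlled(4)]])
          (use that I in auto)
    qed (use ij z M in auto)
  qed
  show ?thesis
    using close G0 D unfolding grid_lipschitz_def close_at_def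
    by (intro exI[of _ "G * D"]) (auto simp: mult.assoc)
qed

lemma ex_refinement_bound:
  "\<exists>G. \<forall>k\<ge>m. \<forall>i\<le>2^(k-m). \<forall>j\<le>2^(k-m). \<forall>z\<le>R.
    close_at (G * mesh k) (\<lambda>i j. A (Suc k) (2 * i) (2 * j)) (\<lambda>i j. B (Suc k) (2 * i) (2 * j))
      (\<lambda>i j. T (Suc k) (2 * i) (2 * j)) (A k) (B k) (T k) i j z"
proof -
  obtain L where L: "0 \<le> L" and lip: "\<And>z. z \<le> R \<Longrightarrow> grid_lipschitz m L (\<lambda>k i j. A k i j z)"
      "\<And>z. z \<le> R \<Longrightarrow> grid_lipschitz m L (\<lambda>k i j. B k i j z)" "\<And>z. z \<le> R \<Longrightarrow> grid_lipschitz m L (\<lambda>k i j. T k i j z)"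
    using ex_grid_lipschitz by blast
  obtain G where G: "comparison_factor R G" using ex_comparison_factor by blast
  \<comment> \<open>Coarsening the finer solution leaves the defect
    \<open>(C + K * L) * mesh (Suc k)\<close>; the data of the two levels differ by at most
    \<open>C * mesh (Suc k) + C * mesh k\<close>. Both are at most
    \<open>D * mesh k\<close>.\<close>
  define D where "D = 2 * C + K * L"
  have D: "0 \<le> D" using K C L by (simp add: D_def)
  have "close_at (G * (D * mesh k)) (\<lambda>i j. A (Suc k) (2 * i) (2 * j)) (\<lambda>i j. B (Suc k) (2 * i) (2 * j))
      (\<lambda>i j. T (Suc k) (2 * i) (2 * j)) (A k) (B k) (T k) i j z"
    if k: "m \<le> k" and ijz: "i \<le> 2^(k-m)" "j \<le> 2^(k-m)" "z \<le> R" for k i j z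
  proof (rule comparison_factorD[OF G _ _ _ all_inside[OF k] _ mesh_le_1[OF k] mesh_le_1[OF k] _ _ _ _ ijz])
    have mk: "m \<le> Suc k" using k by simp
    have N: "(2::nat)^(Suc k - m) = 2 * 2^(k-m)" using k by (simp add: Suc_diff_le)
    note all_inside' = all_inside[OF mk, unfolded N]
    show "all_inside (2^(k-m)) (2^(k-m)) (\<lambda>i j. A (Suc k) (2 * i) (2 * j))
        (\<lambda>i j. B (Suc k) (2 * i) (2 * j)) (\<lambda>i j. T (Suc k) (2 * i) (2 * j))"
      using all_inside' by (auto simp: all_inside_def inside_def)
    have def2: "defect (2 * mesh (Suc k)) (C * mesh (Suc k) + K * (L * mesh (Suc k))) (2^(k-m)) (2^(k-m))
      (\<lambda>i j. A (Suc k) (2 * i) (2 * j)) (\<lambda>i j. B (Suc k) (2 * i) (2 * j)) (\<lambda>i j. T (Suc k) (2 * i) (2 * j))"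
    proof (rule defect_coarsen[OF defect[OF mk, unfolded N] all_inside'])
      show "close_at (L * mesh (Suc k)) (\<lambda>i. A (Suc k) (Suc i)) (\<lambda>i. B (Suc k) (Suc i)) (\<lambda>i. T (Suc k) (Suc i))
          (A (Suc k)) (B (Suc k)) (T (Suc k)) i j z"
        if "i < 2 * 2^(k-m)" "j \<le> 2 * 2^(k-m)" "z \<le> R" for i j z
        using grid_lipschitzD(1)[OF lip(1)[OF that(3)] mk, unfolded N, OF that(1,2)]
          grid_lipschitzD(1)[OF lip(2)[OF that(3)] mk, unfolded N, OF that(1,2)]
          grid_lipschitzD(1)[OF lip(3)[OF that(3)] mk, unfolded N, OF that(1,2)]
        unfolding close_at_def by blast
      show "close_at (L * mesh (Suc k)) (\<lambda>i j. A (Suc k) i (Suc j)) (\<lambda>i j. B (Suc k) i (Suc j)) (\<lambda>i j. T (Suc k) i (Suc j))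
          (A (Suc k)) (B (Suc k)) (T (Suc k)) i j z"
        if "i \<le> 2 * 2^(k-m)" "j < 2 * 2^(k-m)" "z \<le> R" for i j z
        using grid_lipschitzD(2)[OF lip(1)[OF that(3)] mk, unfolded N, OF that(1,2)]
          grid_lipschitzD(2)[OF lip(2)[OF that(3)] mk, unfolded N, OF that(1,2)]
          grid_lipschitzD(2)[OF lip(3)[OF that(3)] mk, unfolded N, OF that(1,2)]
        unfolding close_at_def by blast
    qed (use L in auto)
    have le: "C * mesh (Suc k) + K * (L * mesh (Suc k)) \<le> D * mesh k"
    proof -
      have "(C + K * L) * mesh (Suc k) \<le> D * mesh k"
        using C K L by (intro mult_mono) (auto simp: D_def)
      then show ?thesis by (simp only: distrib_right mult.assoc)
    qed
    have half: "2 * mesh (Suc k) = mesh k" by simp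
    show "defect (mesh k) (D * mesh k) (2^(k-m)) (2^(k-m))
      (\<lambda>i j. A (Suc k) (2 * i) (2 * j)) (\<lambda>i j. B (Suc k) (2 * i) (2 * j)) (\<lambda>i j. T (Suc k) (2 * i) (2 * j))"
      by (rule defect_mono[OF def2 le, unfolded half]) simp
    have CD: "C * mesh (Suc k) + C * mesh k \<le> D * mesh k"
      using C K L by (simp add: D_def algebra_simps)
    show "defect (mesh k) (D * mesh k) (2^(k-m)) (2^(k-m)) (A k) (B k) (T k)"
      using defect[OF k] by (rule defect_mono) (use C K L in \<open>auto simp: D_def intro!: mult_right_mono\<close>)
    have via: "norm (x - x') \<le> D * mesh k"
      if "norm (x - y) \<le> C * mesh (Suc k)" "norm (x' - y) \<le> C * mesh k" for x x' y :: 'a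
    proof -
      have "norm (y - x') \<le> C * mesh k" using that(2) by (simp only: norm_minus_commute)
      then have "norm ((x - y) + (y - x')) \<le> C * mesh (Suc k) + C * mesh k"
        by (rule norm_triangle_mono[OF that(1)])
      then show ?thesis using CD by (simp only: diff_add_cancel add_diff_eq)
    qed
    have mesh2: "mesh (Suc k) * real (2 * i) = mesh k * real i" for i by simp
    show "norm (A (Suc k) (2 * i) (2 * 0) 0 - A k i 0 0) \<le> D * mesh k" if "i \<le> 2^(k-m)" for i
      using via[OF data(1)[OF mk, of "2 * i", unfolded mesh2] data(1)[OF k, of i]] that N by simp
    show "norm (B (Suc k) (2 * 0) (2 * i) 0 - B k 0 i 0) \<le> D * mesh k" if "i \<le> 2^(k-m)" for i
      using via[OF data(2)[OF mk, of "2 * i", unfolded mesh2] data(2)[OF k, of i]] that N by simp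
    show "norm (T (Suc k) (2 * 0) (2 * 0) z - T k 0 0 z) \<le> D * mesh k" if "z \<le> R" for z
      using via[OF data(3)[OF mk that] data(3)[OF k that]] by simp
    show "0 \<le> D * mesh k" using D by simp
  qed auto
  then show ?thesis by (intro exI[of _ "G * D"]) (simp add: mult.assoc)
qed

end

section \<open>The limit of approximate solutions\<close>

lemma grid_lipschitz_transpose: "grid_lipschitz m L X \<Longrightarrow> grid_lipschitz m L (\<lambda>k i j. X k j i)"
  by (auto simp: grid_lipschitz_def)

lemma grid_limit_transpose: "grid_limit m C X Y \<Longrightarrow> grid_limit m C (\<lambda>k i j. X k j i) (\<lambda>x y. Y y x)"
  by (auto simp: grid_limit_def)

text \<open>Continuity of \<open>F\<close> is known only on the sets, so closedness is used first to
  place the limit points in them.\<close>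

lemma controlled_LIMSEQ:
  assumes F: "controlled K S S' F" and S: "closed S" "closed S'"
    and P: "\<And>k. m \<le> k \<Longrightarrow> P k \<in> S" "\<And>k. m \<le> k \<Longrightarrow> Q k \<in> S'"
    and lim: "P \<longlonglongrightarrow> p" "Q \<longlonglongrightarrow> q"
  shows "(\<lambda>k. F (P k) (Q k)) \<longlonglongrightarrow> F p q"
proof (rule LIM_zero_cancel, rule Lim_null_comparison)
  have ev: "\<forall>\<^sub>F k in sequentially. P k \<in> S" "\<forall>\<^sub>F k in sequentially. Q k \<in> S'"
    using P by (auto simp: eventually_sequentially)
  have pq: "p \<in> S" "q \<in> S'"
    using Lim_in_closed_set[OF S(1) ev(1) _ lim(1)] Lim_in_closed_set[OF S(2) ev(2) _ lim(2)] by auto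
  show "\<forall>\<^sub>F k in sequentially. norm (F (P k) (Q k) - F p q) \<le> K * (norm (P k - p) + norm (Q k - q))"
    using ev by eventually_elim (rule controlled_lipschitz[OF F _ pq(1) _ pq(2)])
  have "(\<lambda>k. K * (norm (P k - p) + norm (Q k - q))) \<longlonglongrightarrow> K * (norm (p - p) + norm (q - q))"
    by (intro tendsto_intros lim)
  then show "(\<lambda>k. K * (norm (P k - p) + norm (Q k - q))) \<longlonglongrightarrow> 0" by simp
qed

text \<open>Stated for the y-direction only; equations in x follow by transposing indices. The
  constant \<open>max C (2 * K * L)\<close> covers the one-step defect and the variation of
  \<open>F\<close> along a column. The column \<open>idx k x\<close> moves with \<open>k\<close>,
  which is harmless because only its limit enters.\<close>

lemma grid_equation_limit:
  fixes X :: "nat \<Rightarrow> nat \<Rightarrow> nat \<Rightarrow> 'a::real_normed_vector"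
    and P :: "nat \<Rightarrow> nat \<Rightarrow> nat \<Rightarrow> 'b::real_normed_vector"
    and Q :: "nat \<Rightarrow> nat \<Rightarrow> nat \<Rightarrow> 'c::real_normed_vector"
  assumes F: "controlled K S S' F" "0 \<le> K" and S: "closed S" "closed S'"
    and PQ: "\<And>k i j. \<lbrakk>m \<le> k; i \<le> 2^(k-m); j \<le> 2^(k-m)\<rbrakk> \<Longrightarrow> P k i j \<in> S"
      "\<And>k i j. \<lbrakk>m \<le> k; i \<le> 2^(k-m); j \<le> 2^(k-m)\<rbrakk> \<Longrightarrow> Q k i j \<in> S'"
    and lip: "grid_lipschitz m L P" "grid_lipschitz m L Q"
    and lim: "grid_limit m C' X Y" "grid_limit m C' P p" "grid_limit m C' Q q"
    and step: "\<And>k i j. \<lbrakk>m \<le> k; i \<le> 2^(k-m); j < 2^(k-m)\<rbrakk> \<Longrightarrow>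
      norm (X k i (Suc j) - X k i j - mesh k *\<^sub>R F (P k i j) (Q k i j)) \<le> mesh k * (C * mesh k)"
    and xy: "x \<in> {0..mesh m}" "y \<in> {0..mesh m}"
  shows "((\<lambda>t. Y x t) has_vector_derivative F (p x y) (q x y)) (at y within {0..mesh m})"
proof (rule grid_derivative[where p = "\<lambda>k j. X k (idx k x) j"
      and G = "\<lambda>k j. F (P k (idx k x) j) (Q k (idx k x) j)" and C = "max C (2 * K * L)"])
  show "(\<lambda>k. X k (idx k x) (idx k t)) \<longlonglongrightarrow> Y x t" if "t \<in> {0..mesh m}" for t
    by (rule grid_limit_LIMSEQ[OF lim(1) xy(1) that])
  show "(\<lambda>k. F (P k (idx k x) (idx k t)) (Q k (idx k x) (idx k t))) \<longlonglongrightarrow> F (p x t) (q x t)"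
    if t: "t \<in> {0..mesh m}" for t
    using xy t PQ idx_le
    by (intro controlled_LIMSEQ[where m = m, OF F(1) S] grid_limit_LIMSEQ[OF lim(2)] grid_limit_LIMSEQ[OF lim(3)]) auto
  fix k j :: nat assume k: "m \<le> k" and j: "j < 2^(k-m)"
  have i: "idx k x \<le> 2^(k-m)" using idx_le[OF k] xy by auto
  have "norm (X k (idx k x) (Suc j) - X k (idx k x) j - mesh k *\<^sub>R F (P k (idx k x) j) (Q k (idx k x) j))
      \<le> C * (mesh k)\<^sup>2"
    using step[OF k i j] by (simp only: power2_eq_square mult_ac)
  also have "\<dots> \<le> max C (2 * K * L) * (mesh k)\<^sup>2" by (intro mult_right_mono) auto
  finally show "norm (X k (idx k x) (Suc j) - X k (idx k x) j - mesh k *\<^sub>R F (P k (idx k x) j) (Q k (idx k x) j))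
      \<le> max C (2 * K * L) * (mesh k)\<^sup>2" .
  have "norm (F (P k (idx k x) (Suc j)) (Q k (idx k x) (Suc j)) - F (P k (idx k x) j) (Q k (idx k x) j))
      \<le> 2 * K * (L * mesh k)"
    using j by (intro controlled_lipschitz_le[OF F(1) _ _ _ _ F(2)] PQ k i
        grid_lipschitzD(2)[OF lip(1) k i] grid_lipschitzD(2)[OF lip(2) k i]) auto
  also have "\<dots> = (2 * K * L) * mesh k" by (simp only: mult.assoc)
  also have "\<dots> \<le> max C (2 * K * L) * mesh k" by (intro mult_right_mono) auto
  finally show "norm (F (P k (idx k x) (Suc j)) (Q k (idx k x) (Suc j)) - F (P k (idx k x) j) (Q k (idx k x) j))
      \<le> max C (2 * K * L) * mesh k" .
qed (rule xy)

lemma grid_difference_limit: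
  fixes X X' :: "nat \<Rightarrow> nat \<Rightarrow> nat \<Rightarrow> 'a::real_normed_vector"
    and P :: "nat \<Rightarrow> nat \<Rightarrow> nat \<Rightarrow> 'b::real_normed_vector"
    and Q :: "nat \<Rightarrow> nat \<Rightarrow> nat \<Rightarrow> 'c::real_normed_vector"
  assumes F: "controlled K S S' F" and S: "closed S" "closed S'"
    and PQ: "\<And>k i j. \<lbrakk>m \<le> k; i \<le> 2^(k-m); j \<le> 2^(k-m)\<rbrakk> \<Longrightarrow> P k i j \<in> S"
      "\<And>k i j. \<lbrakk>m \<le> k; i \<le> 2^(k-m); j \<le> 2^(k-m)\<rbrakk> \<Longrightarrow> Q k i j \<in> S'"
    and lim: "grid_limit m C' X Y" "grid_limit m C' X' Y'" "grid_limit m C' P p" "grid_limit m C' Q q"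
    and step: "\<And>k i j. \<lbrakk>m \<le> k; i \<le> 2^(k-m); j \<le> 2^(k-m)\<rbrakk> \<Longrightarrow>
      norm (X' k i j - X k i j - F (P k i j) (Q k i j)) \<le> C * mesh k"
    and xy: "x \<in> {0..mesh m}" "y \<in> {0..mesh m}"
  shows "Y' x y - Y x y = F (p x y) (q x y)"
proof -
  let ?D = "\<lambda>k. X' k (idx k x) (idx k y) - X k (idx k x) (idx k y) - F (P k (idx k x) (idx k y)) (Q k (idx k x) (idx k y))"
  have i: "idx k x \<le> 2^(k-m)" "idx k y \<le> 2^(k-m)" if "m \<le> k" for k using idx_le[OF that] xy by auto
  have "?D \<longlonglongrightarrow> Y' x y - Y x y - F (p x y) (q x y)"
    using PQ i
    by (intro tendsto_diff controlled_LIMSEQ[where m = m, OF F S] grid_limit_LIMSEQ[OF lim(1)] grid_limit_LIMSEQ[OF lim(2)]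
        grid_limit_LIMSEQ[OF lim(3)] grid_limit_LIMSEQ[OF lim(4)] xy) auto
  moreover have "?D \<longlonglongrightarrow> 0"
  proof (rule Lim_null_comparison)
    show "\<forall>\<^sub>F k in sequentially. norm (?D k) \<le> C * mesh k"
      using step i unfolding eventually_sequentially by blast
    show "(\<lambda>k. C * mesh k) \<longlonglongrightarrow> 0"
      using tendsto_mult[OF tendsto_const mesh_LIMSEQ, of C] by simp
  qed
  ultimately have "Y' x y - Y x y - F (p x y) (q x y) = 0" by (rule LIMSEQ_unique)
  then show ?thesis by simp
qed

lemma Lipschitz_on_Omega_grid_limit:
  assumes "\<And>z. z \<le> R \<Longrightarrow> grid_lipschitz m L (\<lambda>k i j. X k i j z)"
    and "\<And>z. z \<le> R \<Longrightarrow> grid_limit m C (\<lambda>k i j. X k i j z) (\<lambda>x y. p (x, y, z))" and L: "0 \<le> L"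
  shows "Lipschitz_on_Omega (mesh m) R p"
  unfolding Lipschitz_on_Omega_def
\<comment> \<open>The factor 2 passes from the sum of the coordinate distances to the distance in
  the plane.\<close>
proof (intro exI[of _ "2 * L"] ballI lipschitz_onI)
  fix z and w w' :: "real \<times> real"
  assume z: "z \<in> {0..R}" and w: "w \<in> {0..mesh m} \<times> {0..mesh m}" "w' \<in> {0..mesh m} \<times> {0..mesh m}"
  obtain x y x' y' where ww: "w = (x, y)" "w' = (x', y')" by (metis surj_pair)
  have "norm (p (x, y, z) - p (x', y', z)) \<le> L * (\<bar>x - x'\<bar> + \<bar>y - y'\<bar>)"
    using z w by (intro grid_limit_lipschitz[OF assms(1,2)]) (auto simp: ww)
  also have "\<dots> \<le> L * (dist w w' + dist w w')"
    using dist_fst_le[of w w'] dist_snd_le[of w w'] L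
    by (intro mult_left_mono add_mono) (auto simp: ww dist_real_def)
  finally show "dist (case w of (x, y) \<Rightarrow> p (x, y, z)) (case w' of (x, y) \<Rightarrow> p (x, y, z)) \<le> 2 * L * dist w w'"
    by (simp add: ww dist_norm)
qed (use L in auto)

lemma data_limit:
  fixes p :: "real \<Rightarrow> 'a::real_normed_vector"
  assumes lip: "C-lipschitz_on {0..mesh m} p"
    and P: "\<And>k i. \<lbrakk>m \<le> k; i \<le> 2^(k-m)\<rbrakk> \<Longrightarrow> norm (P k i - p (mesh k * real i)) \<le> C * mesh k"
    and lim: "(\<lambda>k. P k (idx k x)) \<longlonglongrightarrow> l" and x: "x \<in> {0..mesh m}"
  shows "l = p x"
proof (rule LIMSEQ_unique[OF lim], rule LIM_zero_cancel, rule Lim_null_comparison)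
  show "\<forall>\<^sub>F k in sequentially. norm (P k (idx k x) - p x) \<le> C * mesh k + C * \<bar>mesh k * idx k x - x\<bar>"
    unfolding eventually_sequentially
  proof (intro exI allI impI)
    fix k assume k: "m \<le> k"
    have 1: "norm (P k (idx k x) - p (mesh k * idx k x)) \<le> C * mesh k"
      using P[OF k idx_le[OF k]] x by simp
    have 2: "norm (p (mesh k * idx k x) - p x) \<le> C * \<bar>mesh k * idx k x - x\<bar>"
      using lipschitz_onD[OF lip, of "mesh k * idx k x" x] x idx_bounds(1)[of x k]
      by (simp add: dist_norm)
    show "norm (P k (idx k x) - p x) \<le> C * mesh k + C * \<bar>mesh k * idx k x - x\<bar>"
      using norm_triangle_mono[OF 1 2] by simp
  qed
  have "(\<lambda>k. C * mesh k + C * \<bar>mesh k * idx k x - x\<bar>) \<longlonglongrightarrow> C * 0 + C * \<bar>x - x\<bar>"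
    using x by (intro tendsto_intros mesh_LIMSEQ mesh_idx_LIMSEQ) auto
  then show "(\<lambda>k. C * mesh k + C * \<bar>mesh k * idx k x - x\<bar>) \<longlonglongrightarrow> 0" by simp
qed

context approximating_family
begin

lemma ex_limit_solution:
  obtains a b \<theta> and C' :: real where
    "Lipschitz_on_Omega (mesh m) R a" "Lipschitz_on_Omega (mesh m) R b" "Lipschitz_on_Omega (mesh m) R \<theta>"
    "\<And>z. z \<le> R \<Longrightarrow> grid_limit m C' (\<lambda>k i j. A k i j z) (\<lambda>x y. a (x, y, z))"
    "\<And>z. z \<le> R \<Longrightarrow> grid_limit m C' (\<lambda>k i j. B k i j z) (\<lambda>x y. b (x, y, z))"
    "\<And>z. z \<le> R \<Longrightarrow> grid_limit m C' (\<lambda>k i j. T k i j z) (\<lambda>x y. \<theta> (x, y, z))"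
    "solves_continuous_Goursat (mesh m) R f g u v \<xi> \<eta> a0 b0 \<theta>0 a b \<theta>"
proof -
  obtain L where L: "0 \<le> L" and lip: "\<And>z. z \<le> R \<Longrightarrow> grid_lipschitz m L (\<lambda>k i j. A k i j z)"
      "\<And>z. z \<le> R \<Longrightarrow> grid_lipschitz m L (\<lambda>k i j. B k i j z)" "\<And>z. z \<le> R \<Longrightarrow> grid_lipschitz m L (\<lambda>k i j. T k i j z)"
    using ex_grid_lipschitz by blast
  obtain G where G: "\<And>k i j z. \<lbrakk>m \<le> k; i \<le> 2^(k-m); j \<le> 2^(k-m); z \<le> R\<rbrakk> \<Longrightarrow>
      close_at (G * mesh k) (\<lambda>i j. A (Suc k) (2 * i) (2 * j)) (\<lambda>i j. B (Suc k) (2 * i) (2 * j))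
      (\<lambda>i j. T (Suc k) (2 * i) (2 * j)) (A k) (B k) (T k) i j z"
    using ex_refinement_bound by blast
  define C' where "C' = 2 * (G + L)"
  have "\<exists>Y. grid_limit m C' (\<lambda>k i j. A k i j z) Y" "\<exists>Y. grid_limit m C' (\<lambda>k i j. B k i j z) Y"
    "\<exists>Y. grid_limit m C' (\<lambda>k i j. T k i j z) Y" if z: "z \<le> R" for z
    unfolding C'_def
    using G[OF _ _ _ z] by (intro ex_grid_limit lip[OF z]; simp add: close_at_def)+
  then obtain Ya Yb Yt where Y: "\<And>z. z \<le> R \<Longrightarrow> grid_limit m C' (\<lambda>k i j. A k i j z) (Ya z)"
      "\<And>z. z \<le> R \<Longrightarrow> grid_limit m C' (\<lambda>k i j. B k i j z) (Yb z)"
      "\<And>z. z \<le> R \<Longrightarrow> grid_limit m C' (\<lambda>k i j. T k i j z) (Yt z)"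
    by metis
  define a where "a = (\<lambda>(x, y, z). Ya z x y)"
  define b where "b = (\<lambda>(x, y, z). Yb z x y)"
  define \<theta> where "\<theta> = (\<lambda>(x, y, z). Yt z x y)"
  have lim: "grid_limit m C' (\<lambda>k i j. A k i j z) (\<lambda>x y. a (x, y, z))"
    "grid_limit m C' (\<lambda>k i j. B k i j z) (\<lambda>x y. b (x, y, z))"
    "grid_limit m C' (\<lambda>k i j. T k i j z) (\<lambda>x y. \<theta> (x, y, z))" if "z \<le> R" for z
    using Y[OF that] by (simp_all add: a_def b_def \<theta>_def)
  have I: "A k i j z \<in> SA z" "B k i j z \<in> SB z" "T k i j z \<in> ST z"
    if "z \<le> R" "m \<le> k" "i \<le> 2^(k-m)" "j \<le> 2^(k-m)" for k i j z
    using insideD[OF all_inside[OF that(2)] that(3,4,1)] by auto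
  have d: "inside (A k) (B k) (T k) i j z" if "z \<le> R" "m \<le> k" "i \<le> 2^(k-m)" "j \<le> 2^(k-m)" for k i j z
    using insideD[OF all_inside[OF that(2)] that(3,4,1)] by auto
  note D = defectD[OF defect d]
  note tr = grid_limit_transpose and lt = grid_lipschitz_transpose
  have "solves_continuous_Goursat (mesh m) R f g u v \<xi> \<eta> a0 b0 \<theta>0 a b \<theta>"
    unfolding solves_continuous_Goursat_def
  proof (intro conjI ballI, clarify)
    fix x y z assume xyz: "(x, y, z) \<in> Omega (mesh m) R"
    then have x: "x \<in> {0..mesh m}" and y: "y \<in> {0..mesh m}" and z: "z \<le> R" by (auto simp: Omega_def)
    \<comment> \<open>\<open>lim'\<close> keeps the statement for all layers, since the equations in
      z also involve layer \<open>z + 1\<close>.\<close>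
    note controlled = controlled[OF z] and closed = closed[OF z] and I = I[OF z]
      and lim' = lim and lim = lim[OF z] and lip = lip[OF z]
    have "((\<lambda>t. a (x, t, z)) has_vector_derivative f (a (x, y, z)) (b (x, y, z))) (at y within {0..mesh m})"
      by (rule grid_equation_limit[OF controlled(1) K closed(1,2) I(1,2) lip(1,2) lim(1,1,2) _ x y])
        (use z in \<open>auto intro!: D(1)\<close>)
    moreover have "((\<lambda>t. \<theta> (x, t, z)) has_vector_derivative v (b (x, y, z)) (\<theta> (x, y, z))) (at y within {0..mesh m})"
      by (rule grid_equation_limit[OF controlled(4) K closed(2,3) I(2,3) lip(2,3) lim(3,2,3) _ x y])
        (use z in \<open>auto intro!: D(2)\<close>)
    moreover have "((\<lambda>t. b (t, y, z)) has_vector_derivative g (a (x, y, z)) (b (x, y, z))) (at x within {0..mesh m})"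
      by (rule grid_equation_limit[OF controlled(2) K closed(1,2) I(1,2) lt[OF lip(1)] lt[OF lip(2)]
            tr[OF lim(2)] tr[OF lim(1)] tr[OF lim(2)] _ y x])
        (use z in \<open>auto intro!: D(3)\<close>)
    moreover have "((\<lambda>t. \<theta> (t, y, z)) has_vector_derivative u (a (x, y, z)) (\<theta> (x, y, z))) (at x within {0..mesh m})"
      by (rule grid_equation_limit[OF controlled(3) K closed(1,3) I(1,3) lt[OF lip(1)] lt[OF lip(3)]
            tr[OF lim(3)] tr[OF lim(1)] tr[OF lim(3)] _ y x])
        (use z in \<open>auto intro!: D(4)\<close>)
    moreover have "a (x, y, z + 1) - a (x, y, z) = \<xi> (a (x, y, z)) (\<theta> (x, y, z))" if zR: "z < R"
      by (rule grid_difference_limit[OF controlled(5) closed(1,3) I(1,3) lim(1) lim'(1)[of "z + 1"] lim(1,3) _ x y])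
        (use D(5) zR in auto)
    moreover have "b (x, y, z + 1) - b (x, y, z) = \<eta> (b (x, y, z)) (\<theta> (x, y, z))" if zR: "z < R"
      by (rule grid_difference_limit[OF controlled(6) closed(2,3) I(2,3) lim(2) lim'(2)[of "z + 1"] lim(2,3) _ x y])
        (use D(6) zR in auto)
    ultimately show "((\<lambda>t. a (x, t, z)) has_vector_derivative f (a (x, y, z)) (b (x, y, z))) (at y within {0..mesh m}) \<and>
      ((\<lambda>t. b (t, y, z)) has_vector_derivative g (a (x, y, z)) (b (x, y, z))) (at x within {0..mesh m}) \<and>
      ((\<lambda>t. \<theta> (t, y, z)) has_vector_derivative u (a (x, y, z)) (\<theta> (x, y, z))) (at x within {0..mesh m}) \<and>
      ((\<lambda>t. \<theta> (x, t, z)) has_vector_derivative v (b (x, y, z)) (\<theta> (x, y, z))) (at y within {0..mesh m}) \<and>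
      (z < R \<longrightarrow>
        a (x, y, z + 1) - a (x, y, z) = \<xi> (a (x, y, z)) (\<theta> (x, y, z)) \<and>
        b (x, y, z + 1) - b (x, y, z) = \<eta> (b (x, y, z)) (\<theta> (x, y, z)))"
      by blast
  next
    have idx0: "idx k 0 = 0" for k by (simp add: idx_def)
    have 0: "0 \<in> {0..mesh m}" by simp
    show "a (x, 0, 0) = a0 x" if x: "x \<in> {0..mesh m}" for x
      using data_limit[OF lipschitz_data(1) data(1) _ x] grid_limit_LIMSEQ[OF lim(1) x 0] by (simp add: idx0)
    show "b (0, y, 0) = b0 y" if y: "y \<in> {0..mesh m}" for y
      using data_limit[OF lipschitz_data(2) data(2) _ y] grid_limit_LIMSEQ[OF lim(2) 0 y] by (simp add: idx0)
    show "\<theta> (0, 0, z) = \<theta>0 z" if "z \<in> {0..R}" for z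
    proof (rule LIMSEQ_unique[OF _ LIM_zero_cancel[OF Lim_null_comparison]])
      have z: "z \<le> R" using that by simp
      show "(\<lambda>k. T k 0 0 z) \<longlonglongrightarrow> \<theta> (0, 0, z)"
        using grid_limit_LIMSEQ[OF lim(3)[OF z] 0 0] by (simp add: idx0)
      show "\<forall>\<^sub>F k in sequentially. norm (T k 0 0 z - \<theta>0 z) \<le> C * mesh k"
        using data(3) z unfolding eventually_sequentially by blast
      show "(\<lambda>k. C * mesh k) \<longlonglongrightarrow> 0"
        using tendsto_mult[OF tendsto_const mesh_LIMSEQ, of C] by simp
    qed
  qed
  moreover have "Lipschitz_on_Omega (mesh m) R a" "Lipschitz_on_Omega (mesh m) R b" "Lipschitz_on_Omega (mesh m) R \<theta>"
    by (rule Lipschitz_on_Omega_grid_limit[OF lip(1) lim(1) L] Lipschitz_on_Omega_grid_limit[OF lip(2) lim(2) L]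
        Lipschitz_on_Omega_grid_limit[OF lip(3) lim(3) L]; assumption)+
  ultimately show ?thesis using lim that by blast
qed

end

section \<open>Solutions near the corner\<close>

text \<open>The derivative is bounded near the base point, and the mean value inequality on a convex
  ball gives the Lipschitz bound. Coupling radius \<open>1 / n\<close> and constant \<open>n\<close>
  makes the property eventual in one parameter, so finitely many maps and base points can share one
  \<open>n\<close>.\<close>

lemma C1_eventually_controlled:
  fixes F :: "'a::real_normed_vector \<Rightarrow> 'a \<Rightarrow> 'b::real_normed_vector"
  assumes "C_on 1 UNIV (\<lambda>(p, q). F p q)"
  shows "\<forall>\<^sub>F n in sequentially. controlled (real n) (cball p0 (1 / real n)) (cball q0 (1 / real n)) F"
proof -
  let ?F = "\<lambda>w. F (fst w) (snd w)"
  have F_eq: "(\<lambda>(p, q). F p q) = ?F" by auto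
  obtain F' :: "'a \<times> 'a \<Rightarrow> ('a \<times> 'a) \<Rightarrow>\<^sub>L 'b" where F': "\<And>w. (?F has_derivative F' w) (at w)"
    and cont: "continuous_on UNIV F'"
    using assms unfolding F_eq by auto
  let ?w0 = "(p0, q0)"
  have "isCont F' ?w0" using cont by (simp add: continuous_on_eq_continuous_at)
  then obtain d where d: "0 < d" and d': "\<And>w. dist w ?w0 < d \<Longrightarrow> dist (F' w) (F' ?w0) < 1"
    unfolding continuous_at_eps_delta by (meson zero_less_one)
  define M where "M = norm (F' ?w0) + 1"
  have M: "onorm (F' w) \<le> M" if "w \<in> ball ?w0 d" for w
  proof -
    have "norm (F' w) \<le> norm (F' ?w0) + norm (F' w - F' ?w0)" by (rule norm_triangle_sub)
    moreover have "norm (F' w - F' ?w0) < 1"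
      using d'[of w] that unfolding mem_ball dist_commute[of w] by (simp add: dist_norm)
    ultimately show ?thesis by (simp add: M_def norm_blinfun.rep_eq[symmetric])
  qed
  have M0: "0 \<le> M" by (simp add: M_def)
  have lip: "norm (?F w - ?F w') \<le> M * norm (w - w')" if "w \<in> ball ?w0 d" "w' \<in> ball ?w0 d" for w w'
    by (rule differentiable_bound[OF convex_ball[of ?w0 d] has_derivative_at_withinI[OF F'] M that])
  have lip2: "norm (F p q - F p' q') \<le> M * (norm (p - p') + norm (q - q'))"
    if "(p, q) \<in> ball ?w0 d" "(p', q') \<in> ball ?w0 d" for p q p' q'
  proof -
    have "norm ((p, q) - (p', q')) \<le> norm (p - p') + norm (q - q')"
      by (simp add: norm_Pair sqrt_sum_squares_le_sum)
    then show ?thesis using lip[OF that] M0 by (auto intro: order_trans mult_left_mono)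
  qed
  \<comment> \<open>The first bound puts the product of the two balls into the ball of radius
    \<open>d\<close>; the second bounds the values, since both arguments are within distance 1 of
    the centres, and also exceeds \<open>M\<close>.\<close>
  obtain n0 :: nat where n0: "max (2 / d) (norm (F p0 q0) + 2 * M) < real n0" using reals_Archimedean2 by blast
  have "controlled (real n) (cball p0 (1 / real n)) (cball q0 (1 / real n)) F" if n: "Suc n0 \<le> n" for n
  proof -
    have n1: "1 \<le> real n" "2 / d < real n" "norm (F p0 q0) + 2 * M < real n" using n0 n by auto
    have "2 < real n * d" using n1(2) d by (simp add: field_simps)
    then have nd: "2 / real n < d" using n1(1) by (simp add: field_simps)
    have ball: "(p, q) \<in> ball ?w0 d" if "p \<in> cball p0 (1 / real n)" "q \<in> cball q0 (1 / real n)" for p q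
    proof -
      have "dist ?w0 (p, q) \<le> dist p0 p + dist q0 q"
        by (simp add: dist_Pair_Pair sqrt_sum_squares_le_sum)
      then show ?thesis using that nd by simp
    qed
    have "norm (F p q) \<le> real n" if pq: "p \<in> cball p0 (1 / real n)" "q \<in> cball q0 (1 / real n)" for p q
    proof -
      have "norm (F p q - F p0 q0) \<le> M * (norm (p - p0) + norm (q - q0))"
        using d by (intro lip2 ball pq) auto
      also have "\<dots> \<le> M * (1 + 1)"
      proof (intro mult_left_mono add_mono M0)
        have "1 / real n \<le> 1" using n1 by simp
        then show "norm (p - p0) \<le> 1" "norm (q - q0) \<le> 1"
          using pq by (auto simp: dist_norm norm_minus_commute)
      qed
      finally show ?thesis using norm_triangle_sub[of "F p q" "F p0 q0"] n1(3) by simp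
    qed
    moreover have "norm (F p q - F p' q') \<le> real n * (norm (p - p') + norm (q - q'))"
      if "p \<in> cball p0 (1 / real n)" "q \<in> cball q0 (1 / real n)"
        "p' \<in> cball p0 (1 / real n)" "q' \<in> cball q0 (1 / real n)" for p q p' q'
    proof -
      have "M \<le> real n" using n1(3) M0 norm_ge_zero[of "F p0 q0"] by linarith
      then have "M * (norm (p - p') + norm (q - q')) \<le> real n * (norm (p - p') + norm (q - q'))"
        by (intro mult_right_mono) auto
      then show ?thesis using lip2[OF ball ball, OF that] by linarith
    qed
    ultimately show ?thesis by (auto simp: controlled_def)
  qed
  then show ?thesis unfolding eventually_sequentially by blast
qed

text \<open>Compactness of the interval bounds the derivative globally, so no shrinking is involved.
  The eventual form lets one constant meet this and the approximation bounds together.\<close>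

lemma C1_eventually_lipschitz:
  fixes p :: "real \<Rightarrow> 'a::real_normed_vector"
  assumes "C_on 1 {0..r} p"
  shows "\<forall>\<^sub>F L in at_top. L-lipschitz_on {0..r} p"
proof -
  obtain p' where p': "\<And>x. x \<in> {0..r} \<Longrightarrow> (p has_derivative blinfun_apply (p' x)) (at x within {0..r})"
    and cont: "continuous_on {0..r} p'"
    using assms by (auto simp: Ball_def)
  have "bounded (p' ` {0..r})" by (intro compact_imp_bounded compact_continuous_image cont) auto
  then obtain L where L: "\<And>x. x \<in> {0..r} \<Longrightarrow> norm (p' x) \<le> L" unfolding bounded_iff by blast
  have "(max L 0)-lipschitz_on {0..r} p"
  proof (rule lipschitz_onI)
    fix x y assume xy: "x \<in> {0..r}" "y \<in> {0..r}"
    have "norm (p x - p y) \<le> max L 0 * norm (x - y)"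
      by (rule differentiable_bound[OF _ p' _ xy])
        (use L in \<open>auto simp: norm_blinfun.rep_eq[symmetric] intro: max.coboundedI1\<close>)
    then show "dist (p x) (p y) \<le> max L 0 * dist x y" by (simp add: dist_norm)
  qed simp
  then have "L'-lipschitz_on {0..r} p" if "max L 0 \<le> L'" for L' using that by (rule lipschitz_on_le)
  then show ?thesis unfolding eventually_at_top_linorder by blast
qed

lemma C1_approximates_eventually:
  assumes "C1_approximates E F\<epsilon> F" "bounded B" and E: "\<And>\<epsilon>. \<epsilon> \<in> E \<Longrightarrow> 0 < \<epsilon>"
  shows "\<forall>\<^sub>F C in at_top. \<forall>\<epsilon>\<in>E. \<forall>(p, q)\<in>B. norm (F\<epsilon> \<epsilon> p q - F p q) \<le> C * \<epsilon>"
proof -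
  from assms(1)[unfolded C1_approximates_def, rule_format, OF assms(2)]
  obtain C0 where "\<forall>\<epsilon>\<in>E. \<forall>(p, q)\<in>B. norm (F\<epsilon> \<epsilon> p q - F p q) \<le> C0 * \<epsilon> \<and>
      onorm (\<lambda>h. D1 (F\<epsilon> \<epsilon>) p q h - D1 F p q h) \<le> C0 * \<epsilon> \<and>
      onorm (\<lambda>h. D2 (F\<epsilon> \<epsilon>) p q h - D2 F p q h) \<le> C0 * \<epsilon>" ..
  then have C0: "norm (F\<epsilon> \<epsilon> p q - F p q) \<le> C0 * \<epsilon>" if "\<epsilon> \<in> E" "(p, q) \<in> B" for \<epsilon> p q
    using that by (auto dest!: bspec[of E _ \<epsilon>] bspec[of B _ "(p, q)"])
  have "norm (F\<epsilon> \<epsilon> p q - F p q) \<le> C * \<epsilon>" if "C0 \<le> C" "\<epsilon> \<in> E" "(p, q) \<in> B" for C \<epsilon> p q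
  proof -
    have "C0 * \<epsilon> \<le> C * \<epsilon>" using that(1) E[OF that(2)] by (intro mult_right_mono) auto
    then show ?thesis using C0[OF that(2,3)] by linarith
  qed
  then show ?thesis unfolding eventually_at_top_linorder by blast
qed

lemma bigO_uniformly_eventually:
  assumes "bigO_uniformly E P p\<epsilon> p" and E: "\<And>\<epsilon>. \<epsilon> \<in> E \<Longrightarrow> 0 < \<epsilon>"
  shows "\<forall>\<^sub>F C in at_top. \<forall>\<epsilon>\<in>E. \<forall>t\<in>P \<epsilon>. norm (p\<epsilon> \<epsilon> t - p t) \<le> C * \<epsilon>"
proof -
  obtain C0 where C0: "\<And>\<epsilon> t. \<epsilon> \<in> E \<Longrightarrow> t \<in> P \<epsilon> \<Longrightarrow> norm (p\<epsilon> \<epsilon> t - p t) \<le> C0 * \<epsilon>"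
    using assms(1) unfolding bigO_uniformly_def by blast
  have "norm (p\<epsilon> \<epsilon> t - p t) \<le> C * \<epsilon>" if "C0 \<le> C" "\<epsilon> \<in> E" "t \<in> P \<epsilon>" for C \<epsilon> t
  proof -
    have "C0 * \<epsilon> \<le> C * \<epsilon>" using that(1) E[OF that(2)] by (intro mult_right_mono) auto
    then show ?thesis using C0[OF that(2,3)] by linarith
  qed
  then show ?thesis unfolding eventually_at_top_linorder by blast
qed

context layered_system
begin

text \<open>Here staying in the balls is derived, not assumed. A point on the preceding diagonal
  with distance at most \<open>W n \<le> \<delta>\<close> lies inside, so its defect bound is in
  force, and one step adds at most \<open>e * (K + D)\<close>. Boundedness suffices, hence linear
  rather than exponential growth.\<close>

lemma growth_bound:
  assumes def: "defect e D N M A B T" and e: "0 \<le> e" and D: "0 \<le> D" and z: "z \<le> R"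
    and init: "\<And>i. i \<le> N \<Longrightarrow> norm (A i 0 z - p) \<le> c" "\<And>j. j \<le> M \<Longrightarrow> norm (B 0 j z - q) \<le> c"
      "norm (T 0 0 z - t) \<le> c"
    and S: "cball p \<delta> \<subseteq> SA z" "cball q \<delta> \<subseteq> SB z" "cball t \<delta> \<subseteq> ST z"
    and c: "c + e * (N + M) * (K + D) \<le> \<delta>" and ij: "i \<le> N" "j \<le> M"
  shows "norm (A i j z - p) \<le> c + e * (N + M) * (K + D) \<and> norm (B i j z - q) \<le> c + e * (N + M) * (K + D) \<and>
    norm (T i j z - t) \<le> c + e * (N + M) * (K + D)"
proof -
  define W where "W n = c + e * real n * (K + D)" for n
  have W_mono: "W n \<le> W n'" if "n \<le> n'" for n n'
    unfolding W_def using that e K D by (intro add_left_mono mult_right_mono mult_left_mono) auto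
  have W_\<delta>: "W n \<le> \<delta>" if "n \<le> N + M" for n
    using W_mono[OF that] c by (simp add: W_def)
  have step: "norm (x1 - y) \<le> W (Suc n)"
    if "norm (x1 - x - e *\<^sub>R F') \<le> e * D" "norm F' \<le> K" "norm (x - y) \<le> W n" for x1 x F' y :: 'a and n
    using norm_triangle_mono[OF step_bound[OF that(1,2) e] that(3)] by (simp add: W_def algebra_simps)
  have I: "inside A B T i j z"
    if "i + j \<le> N + M" "norm (A i j z - p) \<le> W (i + j)" "norm (B i j z - q) \<le> W (i + j)"
      "norm (T i j z - t) \<le> W (i + j)" for i j
    using S W_\<delta>[OF that(1)] that(2-4) unfolding inside_def
    by (auto simp: dist_norm norm_minus_commute subset_iff)
  have "norm (A i j z - p) \<le> W (i + j) \<and> norm (B i j z - q) \<le> W (i + j) \<and> norm (T i j z - t) \<le> W (i + j)"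
  proof (rule grid_bound[where N = N and M = M])
    fix i j assume ij: "i \<le> N" "j < M" and w: "norm (A i j z - p) \<le> W (i + j)" "norm (B i j z - q) \<le> W (i + j)"
      "norm (T i j z - t) \<le> W (i + j)"
    have J: "inside A B T i j z" using ij by (intro I w) auto
    note d = defectD[OF def J]
    show "norm (A i (Suc j) z - p) \<le> W (Suc (i + j)) \<and> norm (T i (Suc j) z - t) \<le> W (Suc (i + j))"
      using ij z J w d
      by (intro conjI step[where F' = "f (A i j z) (B i j z)"] step[where F' = "v (B i j z) (T i j z)"]
        controlled_bound[OF controlled(1)] controlled_bound[OF controlled(4)]) (auto simp: inside_def)
  next
    fix i j assume ij: "i < N" "j \<le> M" and w: "norm (A i j z - p) \<le> W (i + j)" "norm (B i j z - q) \<le> W (i + j)"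
      "norm (T i j z - t) \<le> W (i + j)"
    have J: "inside A B T i j z" using ij by (intro I w) auto
    note d = defectD[OF def J]
    show "norm (B (Suc i) j z - q) \<le> W (Suc (i + j)) \<and> norm (T (Suc i) j z - t) \<le> W (Suc (i + j))"
      using ij z J w d
      by (intro conjI step[where F' = "g (A i j z) (B i j z)"] step[where F' = "u (A i j z) (T i j z)"]
        controlled_bound[OF controlled(2)] controlled_bound[OF controlled(3)]) (auto simp: inside_def)
  next
    have c': "c \<le> W n" for n using W_mono[of 0 n] by (simp add: W_def)
    show "norm (A i 0 z - p) \<le> W i" if "i \<le> N" for i using init(1)[OF that] c'[of i] by linarith
    show "norm (B 0 j z - q) \<le> W j" if "j \<le> M" for j using init(2)[OF that] c'[of j] by linarith
    show "norm (T 0 0 z - t) \<le> W 0" using init(3) c'[of 0] by linarith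
  qed (use ij in auto)
  moreover have "W (i + j) \<le> c + e * (N + M) * (K + D)"
    using W_mono[of "i + j" "N + M"] ij by (simp add: W_def)
  ultimately show ?thesis by linarith
qed

end

text \<open>The centres are the corner values the limit must have: \<open>PT\<close> is prescribed,
  and \<open>PA\<close>, \<open>PB\<close> arise by iterating the exact \<xi> and \<eta> at the
  corner. Unlike in \<open>approximating_family\<close>, values are not assumed to stay in the
  balls.\<close>

locale base_point_family =
  layered_system f g u v \<xi> \<eta> "\<lambda>z. cball (PA z) \<delta>" "\<lambda>z. cball (PB z) \<delta>" "\<lambda>z. cball (PT z) \<delta>" R K
  for f g u v \<xi> \<eta> :: "'a::banach \<Rightarrow> 'a \<Rightarrow> 'a" and PA PB PT \<delta> R K +
  fixes A B T :: "nat \<Rightarrow> nat \<Rightarrow> nat \<Rightarrow> nat \<Rightarrow> 'a" and m :: nat and C :: real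
    and a0 b0 :: "real \<Rightarrow> 'a"
  assumes C: "0 \<le> C" and \<delta>: "0 < \<delta>"
    and base_0: "PA 0 = a0 0" "PB 0 = b0 0"
    and base_Suc: "PA (Suc z) = PA z + \<xi> (PA z) (PT z)" "PB (Suc z) = PB z + \<eta> (PB z) (PT z)"
    and defect: "m \<le> k \<Longrightarrow> defect (mesh k) (C * mesh k) (2^(k-m)) (2^(k-m)) (A k) (B k) (T k)"
    and data: "m \<le> k \<Longrightarrow> i \<le> 2^(k-m) \<Longrightarrow> norm (A k i 0 0 - a0 (mesh k * i)) \<le> C * mesh k"
      "m \<le> k \<Longrightarrow> i \<le> 2^(k-m) \<Longrightarrow> norm (B k 0 i 0 - b0 (mesh k * i)) \<le> C * mesh k"
      "m \<le> k \<Longrightarrow> z \<le> R \<Longrightarrow> norm (T k 0 0 z - PT z) \<le> C * mesh k"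
    and lipschitz_data: "C-lipschitz_on {0..mesh m} a0" "C-lipschitz_on {0..mesh m} b0"
begin

definition near where
  "near z c n \<longleftrightarrow> (\<forall>k\<ge>n. \<forall>i\<le>2^(k-n). \<forall>j\<le>2^(k-n).
    norm (A k i j z - PA z) \<le> c \<and> norm (B k i j z - PB z) \<le> c \<and> norm (T k i j z - PT z) \<le> c)"

text \<open>Across a square of side \<open>mesh n\<close> a grid path has length at most
  \<open>2 * mesh n\<close>, and the increment per unit length is at most
  \<open>K + C\<close>.\<close>

lemma near_layer:
  assumes z: "z \<le> R" and mn: "m \<le> n" and c: "C * mesh n \<le> c"
    and init: "\<And>k i. \<lbrakk>n \<le> k; i \<le> 2^(k-n)\<rbrakk> \<Longrightarrow> norm (A k i 0 z - PA z) \<le> c"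
      "\<And>k j. \<lbrakk>n \<le> k; j \<le> 2^(k-n)\<rbrakk> \<Longrightarrow> norm (B k 0 j z - PB z) \<le> c"
    and \<eta>: "c + 2 * (K + C) * mesh n \<le> \<eta>'" "\<eta>' \<le> \<delta>"
  shows "near z \<eta>' n"
  unfolding near_def
proof (intro allI impI)
  fix k i j :: nat assume k: "n \<le> k" and ij: "i \<le> 2^(k-n)" "j \<le> 2^(k-n)"
  have Cm: "0 \<le> C * mesh k" "C * mesh k \<le> C" using C by (simp_all add: mult_left_le power_le_one)
  have le: "mesh k \<le> mesh n" using k by (intro power_decreasing) auto
  have "mesh k * real (2^(k-n) + 2^(k-n)) = 2 * mesh n"
    using mesh_mult_power[OF k] by (simp add: distrib_left)
  moreover have "2 * mesh n * (K + C * mesh k) \<le> 2 * mesh n * (K + C)"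
    using Cm by (intro mult_left_mono) auto
  ultimately have "mesh k * real (2^(k-n) + 2^(k-n)) * (K + C * mesh k) \<le> 2 * mesh n * (K + C)"
    by (simp only:)
  also have "\<dots> = 2 * (K + C) * mesh n" by simp
  finally have g: "c + mesh k * real (2^(k-n) + 2^(k-n)) * (K + C * mesh k) \<le> \<eta>'"
    using \<eta>(1) by linarith
  have "(2::nat)^(k-n) \<le> 2^(k-m)" using mn by (intro power_increasing) auto
  then have def: "defect (mesh k) (C * mesh k) (2^(k-n)) (2^(k-n)) (A k) (B k) (T k)"
    using defect_restrict[OF defect] k mn by auto
  have "C * mesh k \<le> C * mesh n" using C le by (intro mult_left_mono)
  then have t: "norm (T k 0 0 z - PT z) \<le> c"
    using data(3)[of k z] z k mn c by linarith
  have m0: "0 \<le> mesh k" by simp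
  show "norm (A k i j z - PA z) \<le> \<eta>' \<and> norm (B k i j z - PB z) \<le> \<eta>' \<and> norm (T k i j z - PT z) \<le> \<eta>'"
    using growth_bound[OF def m0 Cm(1) z init(1)[OF k] init(2)[OF k] t order_refl order_refl order_refl
        order_trans[OF g \<eta>(2)] ij] g by auto
qed

lemma small_mesh: "0 < c \<Longrightarrow> \<forall>\<^sub>F n in sequentially. b * mesh n < c"
  using order_tendstoD(2)[OF tendsto_mult[OF tendsto_const mesh_LIMSEQ, of b]] by simp

text \<open>The radius \<open>c\<close> is generalised in the induction: reaching it on the next
  layer requires a smaller radius on the current one, obtained by a further shrinking of the
  square.\<close>

lemma eventually_near:
  assumes "z \<le> R" "0 < c"
  shows "\<forall>\<^sub>F n in sequentially. near z c n"
  using assms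
proof (induction z arbitrary: c)
  case 0
  have small: "\<forall>\<^sub>F n in sequentially. (4 * C + 2 * K) * mesh n < min c \<delta>"
    using 0 \<delta> by (intro small_mesh) auto
  show ?case
    using small eventually_ge_at_top[of m]
  proof eventually_elim
    case (elim n)
    \<comment> \<open>One \<open>C * mesh n\<close> is the approximation of the data, the other the
      Lipschitz variation over the shortened axis.\<close>
    have data_near: "norm (P i - p 0) \<le> 2 * C * mesh n"
      if p: "C-lipschitz_on {0..mesh m} p" and k: "n \<le> k" and i: "i \<le> 2^(k-n)"
        and P: "\<And>i. i \<le> 2^(k-m) \<Longrightarrow> norm (P i - p (mesh k * real i)) \<le> C * mesh k"
      for k and P :: "nat \<Rightarrow> 'a" and p and i :: nat
    proof -
      have le: "mesh k \<le> mesh n" "mesh n \<le> mesh m" using k elim by (auto intro: power_decreasing)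
      have "real i \<le> real (2^(k-n))" using i of_nat_mono by blast
      then have "mesh k * real i \<le> mesh k * real (2^(k-n))" by (intro mult_left_mono) auto
      then have h: "mesh k * real i \<le> mesh n" using mesh_mult_power[OF k] by simp
      have "i \<le> 2^(k-m)" using i elim by (meson diff_le_mono2 le_trans one_le_numeral power_increasing)
      moreover have "C * mesh k \<le> C * mesh n" using C le by (intro mult_left_mono)
      ultimately have 1: "norm (P i - p (mesh k * real i)) \<le> C * mesh n" using P[of i] by linarith
      have "norm (p (mesh k * real i) - p 0) \<le> C * (mesh k * real i)"
        using lipschitz_onD[OF p, of "mesh k * real i" 0] h le by (simp add: dist_norm)
      also have "\<dots> \<le> C * mesh n" using C h by (intro mult_left_mono)
      finally have 2: "norm (p (mesh k * real i) - p 0) \<le> C * mesh n" .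
      show ?thesis using norm_triangle_mono[OF 1 2] by simp
    qed
    have "near 0 (min c \<delta>) n"
    proof (rule near_layer[where c = "2 * C * mesh n"])
      show "norm (A k i 0 0 - PA 0) \<le> 2 * C * mesh n" if "n \<le> k" "i \<le> 2^(k-n)" for k i
        unfolding base_0 using that elim
        by (intro data_near[OF lipschitz_data(1), where P = "\<lambda>i. A k i 0 0"]) (auto intro!: data(1))
      show "norm (B k 0 j 0 - PB 0) \<le> 2 * C * mesh n" if "n \<le> k" "j \<le> 2^(k-n)" for k j
        unfolding base_0 using that elim
        by (intro data_near[OF lipschitz_data(2), where P = "\<lambda>j. B k 0 j 0"]) (auto intro!: data(2))
      show "2 * C * mesh n + 2 * (K + C) * mesh n \<le> min c \<delta>"
        using elim(1) by (simp add: algebra_simps)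
    qed (use elim C in auto)
    then show ?case by (simp add: near_def)
  qed
next
  case (Suc z)
  \<comment> \<open>A z-step enlarges the radius by the factor \<open>1 + 2 * K\<close>, so
    \<open>c'\<close> spends half of the allowed \<open>min c \<delta>\<close>; the other half pays
    for the mesh terms. \<open>c' \<le> \<delta>\<close> ensures that layer \<open>z\<close> lies in
    its balls, where the z-step is controlled.\<close>
  define c' where "c' = min \<delta> (min c \<delta> / (2 * (1 + 2 * K)))"
  have c': "0 < c'" "c' \<le> \<delta>" using Suc.prems \<delta> K by (auto simp: c'_def)
  have "(1 + 2 * K) * c' \<le> (1 + 2 * K) * (min c \<delta> / (2 * (1 + 2 * K)))"
    using K by (intro mult_left_mono) (auto simp: c'_def)
  also have "\<dots> = min c \<delta> / 2" using K by (simp add: field_simps)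
  finally have c'2: "(1 + 2 * K) * c' \<le> min c \<delta> / 2" .
  have small: "\<forall>\<^sub>F n in sequentially. (4 * C + 2 * K) * mesh n < min c \<delta> / 2"
    using Suc.prems \<delta> by (intro small_mesh) auto
  have zR: "z \<le> R" "z < R" using Suc.prems by auto
  from Suc.IH[OF zR(1) c'(1)] show ?case
    using small eventually_ge_at_top[of m]
  proof eventually_elim
    case (elim n)
    have z_step: "norm (A k i j (Suc z) - PA (Suc z)) \<le> (1 + 2 * K) * c' + C * mesh n \<and>
        norm (B k i j (Suc z) - PB (Suc z)) \<le> (1 + 2 * K) * c' + C * mesh n"
      if k: "n \<le> k" and ij: "i \<le> 2^(k-n)" "j \<le> 2^(k-n)" for k i j
    proof -
      have n: "norm (A k i j z - PA z) \<le> c'" "norm (B k i j z - PB z) \<le> c'" "norm (T k i j z - PT z) \<le> c'"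
        using elim(1) k ij by (auto simp: near_def)
      have I: "A k i j z \<in> cball (PA z) \<delta>" "B k i j z \<in> cball (PB z) \<delta>" "T k i j z \<in> cball (PT z) \<delta>"
        using n c'(2) by (auto simp: dist_norm norm_minus_commute)
      have P: "PA z \<in> cball (PA z) \<delta>" "PB z \<in> cball (PB z) \<delta>" "PT z \<in> cball (PT z) \<delta>" using \<delta> by auto
      have ij': "i \<le> 2^(k-m)" "j \<le> 2^(k-m)"
        using ij elim(3) by (meson diff_le_mono2 le_trans one_le_numeral power_increasing)+
      have "m \<le> k" using k elim by simp
      note d = defectD[OF defect[OF this] _ ij' zR(1)]
      have J: "inside (A k) (B k) (T k) i j z" using I by (simp add: inside_def)
      have le: "C * mesh k \<le> C * mesh n" using C k by (intro mult_left_mono power_decreasing) auto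
      have est: "norm (x1 - (x + y)) \<le> (1 + 2 * K) * c' + C * mesh n"
        if "norm (x1 - x' - 1 *\<^sub>R F) \<le> 1 * (C * mesh k)" "norm (F - y) \<le> 2 * K * c'" "norm (x' - x) \<le> c'"
        for x1 x x' y F :: 'a
        using norm_triangle_mono[OF that(1) norm_triangle_mono[OF that(2,3)]] le
        by (simp add: algebra_simps)
      show ?thesis unfolding base_Suc
        by (intro conjI est[OF d(5)[OF J zR(2)] _ n(1)] est[OF d(6)[OF J zR(2)] _ n(2)]
            controlled_lipschitz_le[OF controlled(5)[OF zR(1)] I(1) P(1) I(3) P(3) K n(1,3)]
            controlled_lipschitz_le[OF controlled(6)[OF zR(1)] I(2) P(2) I(3) P(3) K n(2,3)])
    qed
    have "near (Suc z) (min c \<delta>) n"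
    proof (rule near_layer[where c = "(1 + 2 * K) * c' + C * mesh n"])
      show "(1 + 2 * K) * c' + C * mesh n + 2 * (K + C) * mesh n \<le> min c \<delta>"
      proof -
        have "C * mesh n + 2 * (K + C) * mesh n \<le> (4 * C + 2 * K) * mesh n"
          using C by (simp add: algebra_simps)
        then show ?thesis using elim(2) c'2 by linarith
      qed
    qed (use elim Suc.prems K c' z_step in auto)
    then show ?case by (simp add: near_def)
  qed
qed

text \<open>There are finitely many layers, so one side length works for all of them.\<close>

lemma ex_approximating_family:
  "\<exists>n\<ge>m. approximating_family f g u v \<xi> \<eta> (\<lambda>z. cball (PA z) \<delta>) (\<lambda>z. cball (PB z) \<delta>) (\<lambda>z. cball (PT z) \<delta>) R K
    A B T n C a0 b0 PT"
proof -
  have "\<forall>\<^sub>F n in sequentially. \<forall>z\<in>{..R}. near z \<delta> n"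
    using eventually_near \<delta> by (intro eventually_ball_finite) auto
  then have "\<forall>\<^sub>F n in sequentially. (\<forall>z\<in>{..R}. near z \<delta> n) \<and> m \<le> n"
    by (intro eventually_conj eventually_ge_at_top)
  then obtain n where near: "\<And>z. z \<le> R \<Longrightarrow> near z \<delta> n" and mn: "m \<le> n"
    using eventually_happens'[OF sequentially_bot] by (metis (mono_tags, lifting) atMost_iff)
  have pow: "(2::nat)^(k-n) \<le> 2^(k-m)" for k using mn by (intro power_increasing) auto
  have sub: "{0..mesh n} \<subseteq> {0..mesh m}" using mn by (auto intro: order_trans power_decreasing)
  have "approximating_family f g u v \<xi> \<eta> (\<lambda>z. cball (PA z) \<delta>) (\<lambda>z. cball (PB z) \<delta>) (\<lambda>z. cball (PT z) \<delta>) R K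
    A B T n C a0 b0 PT"
  proof unfold_locales
    fix k assume k: "n \<le> k"
    then have mk: "m \<le> k" using mn by simp
    show "defect (mesh k) (C * mesh k) (2^(k-n)) (2^(k-n)) (A k) (B k) (T k)"
      by (rule defect_restrict[OF defect[OF mk] pow pow])
    show "all_inside (2^(k-n)) (2^(k-n)) (A k) (B k) (T k)"
      using near k by (auto simp: near_def all_inside_def inside_def dist_norm norm_minus_commute)
    show "norm (A k i 0 0 - a0 (mesh k * i)) \<le> C * mesh k" if "i \<le> 2^(k-n)" for i
      using that pow[of k] by (intro data(1)[OF mk]) linarith
    show "norm (B k 0 i 0 - b0 (mesh k * i)) \<le> C * mesh k" if "i \<le> 2^(k-n)" for i
      using that pow[of k] by (intro data(2)[OF mk]) linarith
    show "norm (T k 0 0 z - PT z) \<le> C * mesh k" if "z \<le> R" for z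
      by (rule data(3)[OF mk that])
  qed (use C lipschitz_on_subset[OF _ sub] lipschitz_data in auto)
  with mn show ?thesis by blast
qed

end

section \<open>Discrete solutions as approximate solutions\<close>

lemma grid_mesh_iff: "x \<in> grid (mesh k) \<rho> \<longleftrightarrow> (\<exists>i::nat. x = mesh k * real i \<and> mesh k * real i \<le> \<rho>)"
proof
  assume "x \<in> grid (mesh k) \<rho>"
  then obtain i :: int where i: "x = mesh k * of_int i" "0 \<le> x" "x \<le> \<rho>" by (auto simp: grid_def)
  then have "0 \<le> i" using nonneg_if_mesh[of "of_int i" k] by (simp only: mult.commute of_int_0_le_iff)
  then show "\<exists>i::nat. x = mesh k * real i \<and> mesh k * real i \<le> \<rho>"
    using i by (intro exI[of _ "nat i"]) auto
next
  assume "\<exists>i::nat. x = mesh k * real i \<and> mesh k * real i \<le> \<rho>"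
  then obtain i :: nat where i: "x = mesh k * of_int (int i)" "x \<le> \<rho>" "0 \<le> x" by auto
  then show "x \<in> grid (mesh k) \<rho>" unfolding grid_def by (intro IntI range_eqI[of _ _ "int i"]) simp_all
qed

text \<open>The convergence rate speaks only of levels \<open>k \<ge> m\<close>, but the family may
  contain coarser meshes. On those, the grid in the square consists of the origin alone.\<close>

lemma bigO_uniformly_grid_limit:
  fixes p\<epsilon> :: "real \<Rightarrow> real \<times> real \<times> nat \<Rightarrow> 'a::real_normed_vector"
  assumes lim: "\<And>z. z \<le> R \<Longrightarrow>
    grid_limit m C (\<lambda>k i j. p\<epsilon> (mesh k) (mesh k * real i, mesh k * real j, z)) (\<lambda>x y. p (x, y, z))"
  shows "bigO_uniformly (mesh_sizes k0) (\<lambda>\<epsilon>. Omega_grid \<epsilon> (mesh m) R) p\<epsilon> p"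
proof -
  \<comment> \<open>For the finitely many coarse levels and layers, the error at the origin relative
    to the mesh size is absorbed into the constant.\<close>
  define Q where "Q = (\<lambda>(k, z). norm (p\<epsilon> (mesh k) (0, 0, z) - p (0, 0, z)) / mesh k)"
  define C' where "C' = max C (sum Q ({..<m} \<times> {..R}))"
  have "norm (p\<epsilon> (mesh k) (x, y, z) - p (x, y, z)) \<le> C' * mesh k"
    if "(x, y, z) \<in> Omega_grid (mesh k) (mesh m) R" for k x y z
  proof -
    from that obtain i j :: nat where x: "x = mesh k * real i" "mesh k * real i \<le> mesh m"
      and y: "y = mesh k * real j" "mesh k * real j \<le> mesh m" and z: "z \<le> R"
      by (auto simp: Omega_grid_def grid_mesh_iff)
    show ?thesis
    proof (cases "m \<le> k")
      case True
      have "norm (p\<epsilon> (mesh k) (mesh k * real (idx k x), mesh k * real (idx k y), z) - p (x, y, z)) \<le> C * mesh k"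
        using lim[OF z] True x y unfolding grid_limit_def by auto
      also have "\<dots> \<le> C' * mesh k" by (intro mult_right_mono) (auto simp: C'_def)
      finally show ?thesis by (simp add: x y idx_mesh)
    next
      case False
      then have lt: "mesh m < mesh k" by (intro power_strict_decreasing) auto
      have zero: "n = 0" if "mesh k * real n \<le> mesh m" for n :: nat
      proof (rule ccontr)
        assume "n \<noteq> 0"
        then have "mesh k * 1 \<le> mesh k * real n" by (intro mult_left_mono) auto
        then show False using that lt by linarith
      qed
      have xy: "x = 0" "y = 0" using zero x y by auto
      have "Q (k, z) \<le> sum Q ({..<m} \<times> {..R})"
        using False z by (intro member_le_sum) (auto simp: Q_def)
      then have "Q (k, z) * mesh k \<le> C' * mesh k" by (intro mult_right_mono) (auto simp: C'_def)
      then show ?thesis by (simp add: Q_def xy)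
    qed
  qed
  then show ?thesis unfolding bigO_uniformly_def mesh_sizes_def by (intro exI[of _ C']) auto
qed

context layered_system
begin

text \<open>Replacing the discrete right-hand sides by the continuous ones changes each equation by
  at most \<open>D\<close>. Closeness on the sets suffices because \<open>defect\<close> speaks only
  of points inside them.\<close>

lemma discrete_solution_defect:
  fixes a b \<theta> :: "real \<times> real \<times> nat \<Rightarrow> 'a"
  assumes sol: "solves_discrete_Goursat (mesh k) r R f' g' u' v' \<xi>' \<eta>' a0 b0 \<theta>0 a b \<theta>"
    and N: "mesh k * real N \<le> r"
    and close: "\<And>z p q. \<lbrakk>z \<le> R; p \<in> SA z; q \<in> SB z\<rbrakk> \<Longrightarrow> norm (f' p q - f p q) \<le> D \<and> norm (g' p q - g p q) \<le> D"
      "\<And>z p q. \<lbrakk>z \<le> R; p \<in> SA z; q \<in> ST z\<rbrakk> \<Longrightarrow> norm (u' p q - u p q) \<le> D \<and> norm (\<xi>' p q - \<xi> p q) \<le> D"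
      "\<And>z p q. \<lbrakk>z \<le> R; p \<in> SB z; q \<in> ST z\<rbrakk> \<Longrightarrow> norm (v' p q - v p q) \<le> D \<and> norm (\<eta>' p q - \<eta> p q) \<le> D"
  shows "defect (mesh k) D N N (\<lambda>i j z. a (mesh k * real i, mesh k * real j, z))
    (\<lambda>i j z. b (mesh k * real i, mesh k * real j, z)) (\<lambda>i j z. \<theta> (mesh k * real i, mesh k * real j, z))"
  unfolding defect_def
proof (intro allI impI)
  let ?h = "mesh k"
  let ?a = "\<lambda>i j z. a (?h * real i, ?h * real j, z)" and ?b = "\<lambda>i j z. b (?h * real i, ?h * real j, z)"
    and ?t = "\<lambda>i j z. \<theta> (?h * real i, ?h * real j, z)"
  fix i j z assume ijz: "i \<le> N" "j \<le> N" "z \<le> R" and I: "inside ?a ?b ?t i j z"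
  have h: "?h * real n \<le> r" if "n \<le> N" for n
  proof -
    have "?h * real n \<le> ?h * real N" using that by (intro mult_left_mono) auto
    then show ?thesis using N by linarith
  qed
  \<comment> \<open>Matches the shifted argument of the difference quotient with the next integer
    index.\<close>
  have S: "?h * real n + ?h = ?h * real (Suc n)" for n by (simp add: algebra_simps)
  have P: "(?h * real i, ?h * real j, z) \<in> Omega_grid ?h r R"
    using h ijz by (auto simp: Omega_grid_def grid_mesh_iff)
  have step: "norm (x1 - x - ?h *\<^sub>R F) \<le> ?h * D" if "(x1 - x) /\<^sub>R ?h = F'" "norm (F' - F) \<le> D" for x1 x F F' :: 'a
  proof -
    have "x1 - x = ?h *\<^sub>R F'" using that(1) by auto
    then have "x1 - x - ?h *\<^sub>R F = ?h *\<^sub>R (F' - F)" by (simp add: scaleR_diff_right)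
    then show ?thesis using that(2) by (simp add: mult_left_mono)
  qed
  have eqs: "i < N \<Longrightarrow> (?b (Suc i) j z - ?b i j z) /\<^sub>R ?h = g' (?a i j z) (?b i j z) \<and>
        (?t (Suc i) j z - ?t i j z) /\<^sub>R ?h = u' (?a i j z) (?t i j z)"
      "j < N \<Longrightarrow> (?a i (Suc j) z - ?a i j z) /\<^sub>R ?h = f' (?a i j z) (?b i j z) \<and>
        (?t i (Suc j) z - ?t i j z) /\<^sub>R ?h = v' (?b i j z) (?t i j z)"
      "z < R \<Longrightarrow> ?a i j (Suc z) - ?a i j z = \<xi>' (?a i j z) (?t i j z) \<and>
        ?b i j (Suc z) - ?b i j z = \<eta>' (?b i j z) (?t i j z)"
    using sol[unfolded solves_discrete_Goursat_def, THEN conjunct1, rule_format, OF P] h[of "Suc i"] h[of "Suc j"]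
    by (simp_all only: S split_conv Suc_eq_plus1[symmetric] Suc_le_eq simp_thms)
  from I have I: "?a i j z \<in> SA z" "?b i j z \<in> SB z" "?t i j z \<in> ST z" by (auto simp: inside_def)
  show "(j < N \<longrightarrow>
      norm (?a i (Suc j) z - ?a i j z - ?h *\<^sub>R f (?a i j z) (?b i j z)) \<le> ?h * D \<and>
      norm (?t i (Suc j) z - ?t i j z - ?h *\<^sub>R v (?b i j z) (?t i j z)) \<le> ?h * D) \<and>
    (i < N \<longrightarrow>
      norm (?b (Suc i) j z - ?b i j z - ?h *\<^sub>R g (?a i j z) (?b i j z)) \<le> ?h * D \<and>
      norm (?t (Suc i) j z - ?t i j z - ?h *\<^sub>R u (?a i j z) (?t i j z)) \<le> ?h * D) \<and>
    (z < R \<longrightarrow>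
      norm (?a i j (Suc z) - ?a i j z - \<xi> (?a i j z) (?t i j z)) \<le> D \<and>
      norm (?b i j (Suc z) - ?b i j z - \<eta> (?b i j z) (?t i j z)) \<le> D)"
  proof (intro conjI impI)
    assume j: "j < N"
    show "norm (?a i (Suc j) z - ?a i j z - ?h *\<^sub>R f (?a i j z) (?b i j z)) \<le> ?h * D"
      by (rule step[OF eqs(2)[OF j, THEN conjunct1] close(1)[OF ijz(3) I(1,2), THEN conjunct1]])
    show "norm (?t i (Suc j) z - ?t i j z - ?h *\<^sub>R v (?b i j z) (?t i j z)) \<le> ?h * D"
      by (rule step[OF eqs(2)[OF j, THEN conjunct2] close(3)[OF ijz(3) I(2,3), THEN conjunct1]])
  next
    assume i: "i < N"
    show "norm (?b (Suc i) j z - ?b i j z - ?h *\<^sub>R g (?a i j z) (?b i j z)) \<le> ?h * D"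
      by (rule step[OF eqs(1)[OF i, THEN conjunct1] close(1)[OF ijz(3) I(1,2), THEN conjunct2]])
    show "norm (?t (Suc i) j z - ?t i j z - ?h *\<^sub>R u (?a i j z) (?t i j z)) \<le> ?h * D"
      by (rule step[OF eqs(1)[OF i, THEN conjunct2] close(2)[OF ijz(3) I(1,3), THEN conjunct1]])
  next
    assume z: "z < R"
    show "norm (?a i j (Suc z) - ?a i j z - \<xi> (?a i j z) (?t i j z)) \<le> D"
      unfolding eqs(3)[OF z, THEN conjunct1] using close(2)[OF ijz(3) I(1,3)] by simp
    show "norm (?b i j (Suc z) - ?b i j z - \<eta> (?b i j z) (?t i j z)) \<le> D"
      unfolding eqs(3)[OF z, THEN conjunct2] using close(3)[OF ijz(3) I(2,3)] by simp
  qed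
qed

end

theorem theorem3:
  fixes f g u v \<xi> \<eta> :: "'a::banach \<Rightarrow> 'a \<Rightarrow> 'a"
    and f\<epsilon> g\<epsilon> u\<epsilon> v\<epsilon> \<xi>\<epsilon> \<eta>\<epsilon> :: "real \<Rightarrow> 'a \<Rightarrow> 'a \<Rightarrow> 'a"
    and r :: real and R k0 :: nat
    and a0 b0 :: "real \<Rightarrow> 'a" and \<theta>0 :: "nat \<Rightarrow> 'a"
    and a0\<epsilon> b0\<epsilon> :: "real \<Rightarrow> real \<Rightarrow> 'a" and \<theta>0\<epsilon> :: "real \<Rightarrow> nat \<Rightarrow> 'a"
    and a\<epsilon> b\<epsilon> \<theta>\<epsilon> :: "real \<Rightarrow> real \<times> real \<times> nat \<Rightarrow> 'a"
  assumes r: "r > 0" and R: "R > 0" and k0: "k0 > 0"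
    and smooth_rhs:
      "smooth_on UNIV (\<lambda>(a, b). f a b)" "smooth_on UNIV (\<lambda>(a, b). g a b)"
      "smooth_on UNIV (\<lambda>(a, \<theta>). u a \<theta>)" "smooth_on UNIV (\<lambda>(b, \<theta>). v b \<theta>)"
      "smooth_on UNIV (\<lambda>(a, \<theta>). \<xi> a \<theta>)" "smooth_on UNIV (\<lambda>(b, \<theta>). \<eta> b \<theta>)"
    and compat: "compatible f g u v \<xi> \<eta>"
    and smooth_data: "smooth_on {0..r} a0" "smooth_on {0..r} b0"
    and C1_discrete_rhs:
      "\<And>\<epsilon>. \<epsilon> \<in> mesh_sizes k0 \<Longrightarrow>
        C_on 1 UNIV (\<lambda>(a, b). f\<epsilon> \<epsilon> a b) \<and> C_on 1 UNIV (\<lambda>(a, b). g\<epsilon> \<epsilon> a b) \<and>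
        C_on 1 UNIV (\<lambda>(a, \<theta>). u\<epsilon> \<epsilon> a \<theta>) \<and> C_on 1 UNIV (\<lambda>(b, \<theta>). v\<epsilon> \<epsilon> b \<theta>) \<and>
        C_on 1 UNIV (\<lambda>(a, \<theta>). \<xi>\<epsilon> \<epsilon> a \<theta>) \<and> C_on 1 UNIV (\<lambda>(b, \<theta>). \<eta>\<epsilon> \<epsilon> b \<theta>)"
    and discrete_compat:
      "\<And>\<epsilon>. \<epsilon> \<in> mesh_sizes k0 \<Longrightarrow>
        discrete_compatible \<epsilon> (f\<epsilon> \<epsilon>) (g\<epsilon> \<epsilon>) (u\<epsilon> \<epsilon>) (v\<epsilon> \<epsilon>) (\<xi>\<epsilon> \<epsilon>) (\<eta>\<epsilon> \<epsilon>)"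
    and approx_rhs:
      "C1_approximates (mesh_sizes k0) f\<epsilon> f" "C1_approximates (mesh_sizes k0) g\<epsilon> g"
      "C1_approximates (mesh_sizes k0) u\<epsilon> u" "C1_approximates (mesh_sizes k0) v\<epsilon> v"
      "C1_approximates (mesh_sizes k0) \<xi>\<epsilon> \<xi>" "C1_approximates (mesh_sizes k0) \<eta>\<epsilon> \<eta>"
    and approx_data:
      "bigO_uniformly (mesh_sizes k0) (\<lambda>\<epsilon>. grid \<epsilon> r) a0\<epsilon> a0"
      "bigO_uniformly (mesh_sizes k0) (\<lambda>\<epsilon>. grid \<epsilon> r) b0\<epsilon> b0"
      "bigO_uniformly (mesh_sizes k0) (\<lambda>\<epsilon>. {0..R}) \<theta>0\<epsilon> \<theta>0"
    and discrete_solutions: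
      "\<And>\<epsilon>. \<epsilon> \<in> mesh_sizes k0 \<Longrightarrow>
        solves_discrete_Goursat \<epsilon> r R (f\<epsilon> \<epsilon>) (g\<epsilon> \<epsilon>) (u\<epsilon> \<epsilon>) (v\<epsilon> \<epsilon>) (\<xi>\<epsilon> \<epsilon>) (\<eta>\<epsilon> \<epsilon>)
          (a0\<epsilon> \<epsilon>) (b0\<epsilon> \<epsilon>) (\<theta>0\<epsilon> \<epsilon>) (a\<epsilon> \<epsilon>) (b\<epsilon> \<epsilon>) (\<theta>\<epsilon> \<epsilon>)"
  shows "\<exists>r' a b \<theta>. 0 < r' \<and> r' \<le> r \<and>
      Lipschitz_on_Omega r' R a \<and> Lipschitz_on_Omega r' R b \<and> Lipschitz_on_Omega r' R \<theta> \<and>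
      bigO_uniformly (mesh_sizes k0) (\<lambda>\<epsilon>. Omega_grid \<epsilon> r' R) a\<epsilon> a \<and>
      bigO_uniformly (mesh_sizes k0) (\<lambda>\<epsilon>. Omega_grid \<epsilon> r' R) b\<epsilon> b \<and>
      bigO_uniformly (mesh_sizes k0) (\<lambda>\<epsilon>. Omega_grid \<epsilon> r' R) \<theta>\<epsilon> \<theta> \<and>
      solves_continuous_Goursat r' R f g u v \<xi> \<eta> a0 b0 \<theta>0 a b \<theta>"
proof -
  \<comment> \<open>Corner values of the sought a and b, layer by layer, computed from the data
    before any limit exists.\<close>
  define PA where "PA = rec_nat (a0 0) (\<lambda>z p. p + \<xi> p (\<theta>0 z))"
  define PB where "PB = rec_nat (b0 0) (\<lambda>z p. p + \<eta> p (\<theta>0 z))"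
  have C1: "C_on 1 S p" if "smooth_on S p" for S and p :: "'b::real_normed_vector \<Rightarrow> 'c::real_normed_vector"
    using that unfolding smooth_on_def by blast
  define ctl where "ctl n F P Q \<longleftrightarrow>
      (\<forall>z\<in>{..R}. controlled (real n) (cball (P z) (1 / real n)) (cball (Q z) (1 / real n)) F)"
    for n and F :: "'a \<Rightarrow> 'a \<Rightarrow> 'a" and P Q
  have ctl: "\<forall>\<^sub>F n in sequentially. ctl n F P Q" if "smooth_on UNIV (\<lambda>(p, q). F p q)" for F P Q
    unfolding ctl_def using C1_eventually_controlled[OF C1[OF that]] by (intro eventually_ball_finite) auto
  \<comment> \<open>One \<open>n\<close> for all six maps and all layers; it serves as
    \<open>K\<close>, and its reciprocal as the radius \<delta>.\<close>
  have "\<forall>\<^sub>F n in sequentially. 0 < n \<and> ctl n f PA PB \<and> ctl n g PA PB \<and> ctl n u PA \<theta>0 \<and> ctl n v PB \<theta>0 \<and>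
      ctl n \<xi> PA \<theta>0 \<and> ctl n \<eta> PB \<theta>0"
    by (intro eventually_conj ctl smooth_rhs eventually_gt_at_top)
  then obtain n where n: "0 < n" "ctl n f PA PB" "ctl n g PA PB" "ctl n u PA \<theta>0" "ctl n v PB \<theta>0"
      "ctl n \<xi> PA \<theta>0" "ctl n \<eta> PB \<theta>0"
    using eventually_happens'[OF sequentially_bot] by blast
  define \<delta> where "\<delta> = 1 / real n"
  interpret layered_system f g u v \<xi> \<eta> "\<lambda>z. cball (PA z) \<delta>" "\<lambda>z. cball (PB z) \<delta>" "\<lambda>z. cball (\<theta>0 z) \<delta>" R "real n"
    by unfold_locales (use n in \<open>auto simp: ctl_def \<delta>_def\<close>)

  have E: "0 < \<epsilon>" if "\<epsilon> \<in> mesh_sizes k0" for \<epsilon> using that by (auto simp: mesh_sizes_def)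
  \<comment> \<open>The union over the layers is a single bounded set, on which the approximation
    hypothesis provides a constant.\<close>
  define ball2 where "ball2 P Q = (\<Union>z\<le>R. cball (P z) \<delta> \<times> cball (Q z) \<delta>)" for P Q :: "nat \<Rightarrow> 'a"
  have ball2: "bounded (ball2 P Q)" for P Q
    unfolding ball2_def by (intro bounded_UN) (auto intro: bounded_Times)
  define apx where "apx C F\<epsilon> F P Q \<longleftrightarrow>
      (\<forall>\<epsilon>\<in>mesh_sizes k0. \<forall>(p, q)\<in>ball2 P Q. norm (F\<epsilon> \<epsilon> p q - F p q) \<le> C * \<epsilon>)"
    for C :: real and F\<epsilon> :: "real \<Rightarrow> 'a \<Rightarrow> 'a \<Rightarrow> 'a" and F P Q
  have apx: "\<forall>\<^sub>F C in at_top. apx C F\<epsilon> F P Q" if "C1_approximates (mesh_sizes k0) F\<epsilon> F" for F\<epsilon> F P Q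
    unfolding apx_def by (rule C1_approximates_eventually[OF that ball2 E])
  have "\<forall>\<^sub>F C in at_top. 0 \<le> C \<and> C-lipschitz_on {0..r} a0 \<and> C-lipschitz_on {0..r} b0 \<and>
      (\<forall>\<epsilon>\<in>mesh_sizes k0. \<forall>t\<in>grid \<epsilon> r. norm (a0\<epsilon> \<epsilon> t - a0 t) \<le> C * \<epsilon>) \<and>
      (\<forall>\<epsilon>\<in>mesh_sizes k0. \<forall>t\<in>grid \<epsilon> r. norm (b0\<epsilon> \<epsilon> t - b0 t) \<le> C * \<epsilon>) \<and>
      (\<forall>\<epsilon>\<in>mesh_sizes k0. \<forall>z\<in>{0..R}. norm (\<theta>0\<epsilon> \<epsilon> z - \<theta>0 z) \<le> C * \<epsilon>) \<and>
      apx C f\<epsilon> f PA PB \<and> apx C g\<epsilon> g PA PB \<and> apx C u\<epsilon> u PA \<theta>0 \<and> apx C v\<epsilon> v PB \<theta>0 \<and>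
      apx C \<xi>\<epsilon> \<xi> PA \<theta>0 \<and> apx C \<eta>\<epsilon> \<eta> PB \<theta>0"
    by (intro eventually_conj eventually_ge_at_top C1_eventually_lipschitz C1 smooth_data
        bigO_uniformly_eventually approx_data E apx approx_rhs)
  then obtain C where C: "0 \<le> C" "C-lipschitz_on {0..r} a0" "C-lipschitz_on {0..r} b0"
      "\<forall>\<epsilon>\<in>mesh_sizes k0. \<forall>t\<in>grid \<epsilon> r. norm (a0\<epsilon> \<epsilon> t - a0 t) \<le> C * \<epsilon>"
      "\<forall>\<epsilon>\<in>mesh_sizes k0. \<forall>t\<in>grid \<epsilon> r. norm (b0\<epsilon> \<epsilon> t - b0 t) \<le> C * \<epsilon>"
      "\<forall>\<epsilon>\<in>mesh_sizes k0. \<forall>z\<in>{0..R}. norm (\<theta>0\<epsilon> \<epsilon> z - \<theta>0 z) \<le> C * \<epsilon>"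
    and C': "apx C f\<epsilon> f PA PB" "apx C g\<epsilon> g PA PB" "apx C u\<epsilon> u PA \<theta>0" "apx C v\<epsilon> v PB \<theta>0"
      "apx C \<xi>\<epsilon> \<xi> PA \<theta>0" "apx C \<eta>\<epsilon> \<eta> PB \<theta>0"
    using eventually_happens'[OF trivial_limit_at_top_linorder] by blast
  have apxD: "norm (F\<epsilon> \<epsilon> p q - F p q) \<le> C * \<epsilon>"
    if "apx C F\<epsilon> F P Q" "\<epsilon> \<in> mesh_sizes k0" "z \<le> R" "p \<in> cball (P z) \<delta>" "q \<in> cball (Q z) \<delta>"
    for F\<epsilon> F P Q \<epsilon> z p q
  proof -
    have "(p, q) \<in> ball2 P Q" using that(3-5) unfolding ball2_def by blast
    then show ?thesis using that(1,2) unfolding apx_def by blast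
  qed

  \<comment> \<open>The square of side \<open>mesh m\<close> fits into the given domain, and
    \<open>k0 \<le> m\<close> ensures that every level \<open>k \<ge> m\<close> belongs to the
    family. Invariance of the balls later shrinks \<open>m\<close> to the final
    \<open>m'\<close>.\<close>
  have "\<forall>\<^sub>F m in sequentially. mesh m < r \<and> k0 \<le> m"
    using r by (intro eventually_conj eventually_ge_at_top order_tendstoD(2)[OF mesh_LIMSEQ])
  then obtain m where m: "mesh m < r" "k0 \<le> m"
    using eventually_happens'[OF sequentially_bot] by blast
  define index :: "(real \<Rightarrow> real \<times> real \<times> nat \<Rightarrow> 'a) \<Rightarrow> nat \<Rightarrow> nat \<Rightarrow> nat \<Rightarrow> nat \<Rightarrow> 'a" where
    "index p k i j z = p (mesh k) (mesh k * real i, mesh k * real j, z)" for p k i j z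
  have mesh_in: "mesh k \<in> mesh_sizes k0" if "m \<le> k" for k
    using that m by (auto simp: mesh_sizes_def)
  have N: "mesh k * real (2^(k-m)) \<le> r" if "m \<le> k" for k
    using mesh_mult_power[OF that] m by simp
  have in_grid: "mesh k * real i \<in> grid (mesh k) r" if "m \<le> k" "i \<le> 2^(k-m)" for k i
  proof -
    have "real i \<le> real (2^(k-m))" using that(2) of_nat_mono by blast
    then have "mesh k * real i \<le> mesh k * real (2^(k-m))" by (intro mult_left_mono) auto
    then have "mesh k * real i \<le> r" using N[OF that(1)] by linarith
    then show ?thesis by (auto simp: grid_mesh_iff)
  qed
  have zero_grid: "0 \<in> grid (mesh k) r" for k using r by (auto simp: grid_mesh_iff intro: exI[of _ 0])
  interpret base_point_family f g u v \<xi> \<eta> PA PB \<theta>0 \<delta> R "real n" "index a\<epsilon>" "index b\<epsilon>" "index \<theta>\<epsilon>" m C a0 b0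
  proof unfold_locales
    show "0 \<le> C" "0 < \<delta>" using C n by (auto simp: \<delta>_def)
    show "PA 0 = a0 0" "PB 0 = b0 0" by (simp_all add: PA_def PB_def)
    show "PA (Suc z) = PA z + \<xi> (PA z) (\<theta>0 z)" "PB (Suc z) = PB z + \<eta> (PB z) (\<theta>0 z)" for z
      by (simp_all add: PA_def PB_def)
    fix k assume k: "m \<le> k"
    note sol = discrete_solutions[OF mesh_in[OF k]]
    show "defect (mesh k) (C * mesh k) (2^(k-m)) (2^(k-m)) (index a\<epsilon> k) (index b\<epsilon> k) (index \<theta>\<epsilon> k)"
      unfolding index_def
    proof (rule discrete_solution_defect[OF sol N[OF k]])
      fix z :: nat and p q :: 'a assume z: "z \<le> R"
      note D = apxD[OF _ mesh_in[OF k] z]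
      show "norm (f\<epsilon> (mesh k) p q - f p q) \<le> C * mesh k \<and> norm (g\<epsilon> (mesh k) p q - g p q) \<le> C * mesh k"
        if "p \<in> cball (PA z) \<delta>" "q \<in> cball (PB z) \<delta>"
        using D[OF C'(1) that] D[OF C'(2) that] by blast
      show "norm (u\<epsilon> (mesh k) p q - u p q) \<le> C * mesh k \<and> norm (\<xi>\<epsilon> (mesh k) p q - \<xi> p q) \<le> C * mesh k"
        if "p \<in> cball (PA z) \<delta>" "q \<in> cball (\<theta>0 z) \<delta>"
        using D[OF C'(3) that] D[OF C'(5) that] by blast
      show "norm (v\<epsilon> (mesh k) p q - v p q) \<le> C * mesh k \<and> norm (\<eta>\<epsilon> (mesh k) p q - \<eta> p q) \<le> C * mesh k"
        if "p \<in> cball (PB z) \<delta>" "q \<in> cball (\<theta>0 z) \<delta>"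
        using D[OF C'(4) that] D[OF C'(6) that] by blast
    qed
    show "norm (index a\<epsilon> k i 0 0 - a0 (mesh k * real i)) \<le> C * mesh k" if "i \<le> 2^(k-m)" for i
      using sol in_grid[OF k that] C(4)[rule_format, OF mesh_in[OF k]] by (simp add: index_def solves_discrete_Goursat_def)
    show "norm (index b\<epsilon> k 0 i 0 - b0 (mesh k * real i)) \<le> C * mesh k" if "i \<le> 2^(k-m)" for i
      using sol in_grid[OF k that] C(5)[rule_format, OF mesh_in[OF k]] by (simp add: index_def solves_discrete_Goursat_def)
    show "norm (index \<theta>\<epsilon> k 0 0 z - \<theta>0 z) \<le> C * mesh k" if "z \<le> R" for z
      using sol C(6)[rule_format, OF mesh_in[OF k]] that by (simp add: index_def solves_discrete_Goursat_def)
  qed (use C m lipschitz_on_subset[of C "{0..r}" _ "{0..mesh m}"] in auto)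
  obtain m' where m': "m \<le> m'" and family: "approximating_family f g u v \<xi> \<eta>
      (\<lambda>z. cball (PA z) \<delta>) (\<lambda>z. cball (PB z) \<delta>) (\<lambda>z. cball (\<theta>0 z) \<delta>) R (real n)
      (index a\<epsilon>) (index b\<epsilon>) (index \<theta>\<epsilon>) m' C a0 b0 \<theta>0"
    using ex_approximating_family by blast
  obtain a b \<theta> C'' where lim: "Lipschitz_on_Omega (mesh m') R a" "Lipschitz_on_Omega (mesh m') R b"
    "Lipschitz_on_Omega (mesh m') R \<theta>"
    "\<And>z. z \<le> R \<Longrightarrow> grid_limit m' C'' (\<lambda>k i j. index a\<epsilon> k i j z) (\<lambda>x y. a (x, y, z))"
    "\<And>z. z \<le> R \<Longrightarrow> grid_limit m' C'' (\<lambda>k i j. index b\<epsilon> k i j z) (\<lambda>x y. b (x, y, z))"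
    "\<And>z. z \<le> R \<Longrightarrow> grid_limit m' C'' (\<lambda>k i j. index \<theta>\<epsilon> k i j z) (\<lambda>x y. \<theta> (x, y, z))"
    "solves_continuous_Goursat (mesh m') R f g u v \<xi> \<eta> a0 b0 \<theta>0 a b \<theta>"
    by (rule approximating_family.ex_limit_solution[OF family]) blast
  have "mesh m' \<le> mesh m" using m' by (intro power_decreasing) auto
  then have "0 < mesh m' \<and> mesh m' \<le> r" using m mesh_pos[of m'] by linarith
  moreover note lim(1-3,7) bigO_uniformly_grid_limit[OF lim(4)[unfolded index_def]]
    bigO_uniformly_grid_limit[OF lim(5)[unfolded index_def]]
    bigO_uniformly_grid_limit[OF lim(6)[unfolded index_def]]
  ultimately show ?thesis by blast
qed

end
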